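(* Let $T=(\mathbb C^* )^n$ act on $\mathrm{Gr}(r;n)$ in the standard way. (1) Each $T$-orbit closure in $\mathrm{QGr}(r;n)$ is uniquely determined as a $T$-invariant subvariety of $\mathrm{Gr}(r;n)$ by its $T$-fixed point set. (2) Containment of $T$-orbit closures in $\mathrm{QGr}(r;n)$ corresponds to containment of $T$-fixed points: for $T$-orbit closures $X,Y\subset\mathrm{QGr}(r;n)$, $Y\subseteq X$ if and only if $Y^T\subseteq X^T$.
   Context: $\mathrm{Gr}(r;n)$ is the Grassmannian of $r$-planes in $\mathbb C^n$, with $T$ acting by scaling coordinates. For a $T$-invariant subset $Z$, $Z^T$ denotes its set of $T$-fixed points. A $T$-orbit closure in $\mathrm{QGr}(r;n)$ is a set $\overline{T\cdot x}$ with $x\in \mathrm{QGr}(r;n)$. $[n]=\{1,\dots,n\}$. $\mathrm{NC}_n\subset S_n$ is the set of permutations obtained from noncrossing set partitions of $[n]$ by turning each block $\{b_1<\cdots<b_s\}$ into the cycle $(b_s\,b_{s-1}\,\cdots\,b_1)$ (so $b_s\mapsto b_{s-1}\mapsto\cdots\mapsto b_1\mapsto b_s$) and multiplying these cycles. For $w\in \mathrm{NC}_n$, $\mathrm{Inv}_{\mathrm{NC}}(w)=\{(i,j)\mid i<j,\ w^{-1}(i)>w^{-1}(j),\ (i\,j)w\in\mathrm{NC}_n\}$. $\mathrm{Fl}_n=\mathrm{GL}_n(\mathbb C)/B$ ($B$ the upper triangular matrices) is the complete flag variety; $MB$ corresponds to the flag with $V_i$ the span of the first $i$ columns of $M$.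 For $w\in\mathrm{NC}_n$, $\mathring X^w_{\mathrm{NC}}\subset \mathrm{Fl}_n$ is the set of flags represented by matrices with entry $1$ in positions $(w(j),j)$, arbitrary complex entries in positions $(i,w^{-1}(j))$ for $(i,j)\in\mathrm{Inv}_{\mathrm{NC}}(w)$, and $0$ elsewhere. The quasisymmetric flag variety is the (closed, $T$-invariant) subvariety $\mathrm{QFl}_n=\bigsqcup_{w\in\mathrm{NC}_n}\mathring X^w_{\mathrm{NC}}$ of $\mathrm{Fl}_n$. With $\pi:\mathrm{Fl}_n\to\mathrm{Gr}(r;n)$, $V_\bullet\mapsto V_r$, the quasisymmetric Grassmannian is $\mathrm{QGr}(r;n):=\pi(\mathrm{QFl}_n)$. *)

theory Defs
  imports "HOL-Analysis.Analysis" "HOL-Library.Disjoint_Sets" "Jordan_Normal_Form.Determinant"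
begin

no_notation Matrix.vec_index (infixl "$" 100)

text \<open>
  The index set \<open>[n]\<close> is a finite linearly ordered type \<open>'n\<close>, with \<open>n = CARD('n)\<close>; it is
  order-isomorphic to \<open>{1,\<dots>,n}\<close>, the element \<open>j\<close> having position \<open>card {..j}\<close>.
  The prefix \<open>vec\<close> denotes linear algebra over \<open>\<complex>\<close>, as opposed to the real structure of
  \<open>complex ^ 'n\<close>.
\<close>

type_synonym 'n cvec = "(complex, 'n) Finite_Cartesian_Product.vec"
type_synonym 'n cmat = "('n cvec, 'n) Finite_Cartesian_Product.vec"

subsection \<open>The Grassmannian and its Zariski topology\<close>

definition Gr :: "nat \<Rightarrow> ('n::finite) cvec set set" where
  "Gr r = {V. vec.subspace V \<and> vec.dim V = r}"

text \<open>The maximal minor on the rows \<open>I\<close> of the matrix with columns \<open>vs 0, \<dots>, vs (r - 1)\<close>.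
  Coordinates indexed by sets of the wrong cardinality are set to \<open>0\<close>.\<close>

definition plucker ::
  "nat \<Rightarrow> (nat \<Rightarrow> ('n::{finite,linorder}) cvec) \<Rightarrow> 'n set \<Rightarrow> complex" where
  "plucker r vs I =
     (if card I = r
      then Determinant.det
             (Matrix.mat r r (\<lambda>(a, b). vs b $ (sorted_list_of_set I ! a)))
      else 0)"

text \<open>Homogeneous polynomial functions of the given degree, in variables indexed by \<open>'i\<close>.\<close>

inductive homogeneous_poly :: "nat \<Rightarrow> (('i \<Rightarrow> complex) \<Rightarrow> complex) \<Rightarrow> bool" where
  const: "homogeneous_poly 0 (\<lambda>p. c)"
| var: "homogeneous_poly 1 (\<lambda>p. p i)"
| add: "homogeneous_poly d F \<Longrightarrow> homogeneous_poly d G \<Longrightarrow> homogeneous_poly d (\<lambda>p. F p + G p)"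
| mult: "homogeneous_poly d F \<Longrightarrow> homogeneous_poly e G \<Longrightarrow>
    homogeneous_poly (d + e) (\<lambda>p. F p * G p)"

text \<open>The points of the Grassmannian at which \<open>F\<close> vanishes in the Pluecker embedding. For
  homogeneous \<open>F\<close> the choice of the basis \<open>vs\<close> is immaterial, as it only rescales the
  Pluecker vector.\<close>

definition Gr_zeros ::
  "nat \<Rightarrow> (('n set \<Rightarrow> complex) \<Rightarrow> complex) \<Rightarrow> ('n::{finite,linorder}) cvec set set" where
  "Gr_zeros r F = {V \<in> Gr r. \<forall>vs. vec.span (vs ` {..<r}) = V \<longrightarrow> F (plucker r vs) = 0}"

text \<open>Complements of hypersurface sections form a basis of the Zariski topology. The constant
  polynomial \<open>1\<close> contributes the whole Grassmannian, which is hence the underlying space.\<close>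

definition zariski_Gr :: "nat \<Rightarrow> ('n::{finite,linorder}) cvec set topology" where
  "zariski_Gr r = topology_generated_by {Gr r - Gr_zeros r F | d F. homogeneous_poly d F}"

definition irreducible_in :: "'a topology \<Rightarrow> 'a set \<Rightarrow> bool" where
  "irreducible_in X S \<longleftrightarrow>
     S \<noteq> {} \<and> S \<subseteq> topspace X \<and>
     (\<forall>A B. closedin X A \<and> closedin X B \<and> S \<subseteq> A \<union> B \<longrightarrow> S \<subseteq> A \<or> S \<subseteq> B)"

subsection \<open>The torus action\<close>

definition torus :: "('n::finite) cvec set" where
  "torus = {t. \<forall>i. t $ i \<noteq> 0}"

definition torus_act :: "('n::finite) cvec \<Rightarrow> 'n cvec set \<Rightarrow> 'n cvec set" where
  "torus_act t V = (\<lambda>v. \<chi> i. t $ i * v $ i) ` V"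

definition torus_orbit :: "('n::finite) cvec set \<Rightarrow> 'n cvec set set" where
  "torus_orbit V = (\<lambda>t. torus_act t V) ` torus"

definition torus_invariant :: "('n::finite) cvec set set \<Rightarrow> bool" where
  "torus_invariant Z \<longleftrightarrow> (\<forall>t\<in>torus. \<forall>V\<in>Z. torus_act t V \<in> Z)"

definition torus_fixed :: "('n::finite) cvec set set \<Rightarrow> 'n cvec set set" where
  "torus_fixed Z = {V \<in> Z. \<forall>t\<in>torus. torus_act t V = V}"

text \<open>Subvarieties are irreducible and Zariski closed. Without irreducibility fixed points would not
  determine them: compare the projective line with the pair of its two fixed points.\<close>

definition torus_invariant_subvariety ::
  "nat \<Rightarrow> ('n::{finite,linorder}) cvec set set \<Rightarrow> bool" where
  "torus_invariant_subvariety r Z \<longleftrightarrow>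
     closedin (zariski_Gr r) Z \<and> irreducible_in (zariski_Gr r) Z \<and> torus_invariant Z"

subsection \<open>Noncrossing partitions as permutations\<close>

definition noncrossing :: "'n::linorder set set \<Rightarrow> bool" where
  "noncrossing P \<longleftrightarrow>
     (\<forall>A\<in>P. \<forall>B\<in>P. \<forall>a\<in>A. \<forall>b\<in>B. \<forall>c\<in>A. \<forall>d\<in>B. a < b \<and> b < c \<and> c < d \<longrightarrow> A = B)"

text \<open>The product of the cycles attached to the blocks: on the block \<open>B\<close> of \<open>x\<close> it sends
  \<open>x\<close> to its predecessor in \<open>B\<close>, and the minimum of \<open>B\<close> to its maximum.\<close>

definition partition_perm :: "'n::{finite,linorder} set set \<Rightarrow> 'n \<Rightarrow> 'n" where
  "partition_perm P x =
     (let B = (THE B. B \<in> P \<and> x \<in> B)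
      in if x = Min B then Max B else Max {y \<in> B. y < x})"

definition NC :: "('n::{finite,linorder} \<Rightarrow> 'n) set" where
  "NC = partition_perm ` {P. partition_on UNIV P \<and> noncrossing P}"

definition Inv_NC :: "('n::{finite,linorder} \<Rightarrow> 'n) \<Rightarrow> ('n \<times> 'n) set" where
  "Inv_NC w =
     {(i, j). i < j \<and> inv_into UNIV w i > inv_into UNIV w j \<and> Transposition.transpose i j \<circ> w \<in> NC}"

subsection \<open>The quasisymmetric flag variety and Grassmannian\<close>

text \<open>A flag is the function \<open>i \<mapsto> V\<^sub>i\<close>, with the dummy value \<open>V\<^sub>i = \<complex>\<^sup>n\<close> for \<open>i > n\<close>.\<close>

definition Fl :: "(nat \<Rightarrow> ('n::finite) cvec set) set" where
  "Fl = {V. (\<forall>i \<le> CARD('n). vec.subspace (V i) \<and> vec.dim (V i) = i) \<and>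
            (\<forall>i < CARD('n). V i \<subseteq> V (Suc i)) \<and>
            (\<forall>i > CARD('n). V i = UNIV)}"

definition flag_of :: "('n::{finite,linorder}) cmat \<Rightarrow> nat \<Rightarrow> 'n cvec set" where
  "flag_of M i = vec.span {column j M | j. card {..j} \<le> i}"

definition NC_cell_matrices ::
  "('n::{finite,linorder} \<Rightarrow> 'n) \<Rightarrow> 'n cmat set" where
  "NC_cell_matrices w =
     {M. (\<forall>j. M $ w j $ j = 1) \<and>
         (\<forall>a b. a \<noteq> w b \<and> (a, b) \<notin> {(i, inv_into UNIV w j) | i j. (i, j) \<in> Inv_NC w}
            \<longrightarrow> M $ a $ b = 0)}"

definition NC_cell ::
  "('n::{finite,linorder} \<Rightarrow> 'n) \<Rightarrow> (nat \<Rightarrow> 'n cvec set) set" where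
  "NC_cell w = {V \<in> Fl. \<exists>M \<in> NC_cell_matrices w. V = flag_of M}"

definition QFl :: "(nat \<Rightarrow> ('n::{finite,linorder}) cvec set) set" where
  "QFl = (\<Union>w\<in>NC. NC_cell w)"

definition QGr :: "nat \<Rightarrow> ('n::{finite,linorder}) cvec set set" where
  "QGr r = (\<lambda>V. V r) ` QFl"

definition QGr_orbit_closures :: "nat \<Rightarrow> ('n::{finite,linorder}) cvec set set set" where
  "QGr_orbit_closures r = {zariski_Gr r closure_of (torus_orbit x) | x. x \<in> QGr r}"

end

theory Submission
  imports Defs
begin

text \<open>
  A point \<open>x\<close> of the quasisymmetric Grassmannian is spanned by vectors whose supports form a forest.
  Scaling coordinates and vectors along the forest makes all nonzero entries equal to \<open>1\<close>. Hence
  \<open>x\<close> is determined up to the torus by its matroid, and some point of its orbit is unimodular.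
  The torus fixed points of the closure of the orbit are the coordinate subspaces indexed by the
  bases of the matroid.

  For (1), a generic point of an irreducible subvariety with the same fixed points has the same
  matroid, so it lies in the orbit of \<open>x\<close>.

  For (2), let \<open>y\<close> be another such point all of whose bases are bases of \<open>x\<close>. Reduce both to
  echelon form with respect to a basis of \<open>y\<close> for which the form of \<open>y\<close> is a forest. The support
  of \<open>y\<close> is contained in that of \<open>x\<close>. A one-parameter subgroup degenerating \<open>x\<close> to a point with
  the support of \<open>y\<close> exists unless some closed walk runs through an entry that is lost in \<open>y\<close>; a
  shortest such walk contradicts unimodularity.
\<close>

subsection \<open>Inversions of noncrossing permutations\<close>

text \<open>Forests come from the shape of noncrossing inversions. For \<open>(i, j)\<close> in
  \<open>Inv_NC w\<close>, the value \<open>j\<close> is the maximum of its block while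
  \<open>i\<close> is not the maximum of its own. So inversions never chain, which makes pivot rows
  easy to clear, and a column shares at most one non-pivot row with the earlier columns. The
  obstacle in (2) is that the forest of \<open>x\<close> belongs to its own basis. In the basis
  supplied by \<open>y\<close> the form of \<open>x\<close> is not known to be a forest. A
  degeneration onto the support of \<open>y\<close> needs weights with \<open>h j \<le> h k\<close>
  on the support of \<open>x\<close> and equality exactly on that of \<open>y\<close>, a system that
  an arbitrary \<open>x\<close> may fail to solve. Unimodularity is the consequence of the forest
  that holds in every basis: around a chordless cycle two signs are added, so the result is 0, 2 or
  -2, and the last two are excluded.\<close>

definition nc_rel :: "('n::linorder \<Rightarrow> 'n) \<Rightarrow> ('n \<Rightarrow> 'n \<Rightarrow> bool) \<Rightarrow> bool" where
  "nc_rel u R \<longleftrightarrow> equivp R \<and> (\<forall>x. R x (u x)) \<and>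
     (\<forall>x y. u x < x \<and> R x y \<and> y < x \<longrightarrow> y \<le> u x) \<and>
     (\<forall>x y. x \<le> u x \<and> R x y \<longrightarrow> x \<le> y \<and> y \<le> u x) \<and>
     (\<forall>a b c d. a < b \<and> b < c \<and> c < d \<and> R a c \<and> R b d \<longrightarrow> R a b)"

lemma nc_relD:
  assumes "nc_rel u R"
  shows "R x x" "R x y \<Longrightarrow> R y x" "R x y \<Longrightarrow> R y z \<Longrightarrow> R x z" "R x (u x)"
    "u x < x \<Longrightarrow> R x y \<Longrightarrow> y < x \<Longrightarrow> y \<le> u x"
    "x \<le> u x \<Longrightarrow> R x y \<Longrightarrow> x \<le> y" "x \<le> u x \<Longrightarrow> R x y \<Longrightarrow> y \<le> u x"
    "a < b \<Longrightarrow> b < c \<Longrightarrow> c < d \<Longrightarrow> R a c \<Longrightarrow> R b d \<Longrightarrow> R a b"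
proof -
  have "equivp R" using assms by (simp add: nc_rel_def)
  then show "R x x" "R x y \<Longrightarrow> R y x" "R x y \<Longrightarrow> R y z \<Longrightarrow> R x z"
    by (auto elim: equivpE dest: reflpD sympD transpD)
qed (use assms in \<open>unfold nc_rel_def, blast\<close>)+

text \<open>\<open>R\<close> is the relation of lying in a common block. Only order facts are kept:
  where \<open>u\<close> descends it goes to the next smaller block element, and elsewhere it goes
  from the block minimum to the block maximum. Two permutations can then be compared without
  handling their partitions.\<close>

lemma NC_nc_rel:
  assumes "u \<in> (NC :: ('n::{finite,linorder} \<Rightarrow> 'n) set)"
  obtains R where "nc_rel u R"
proof -
  obtain P :: "'n set set" where P: "partition_on UNIV P" "noncrossing P"
    and u: "u = partition_perm P" using assms by (auto simp: NC_def)
  define R where "R x y \<longleftrightarrow> (\<exists>B\<in>P. x \<in> B \<and> y \<in> B)" for x y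
  have ex: "\<exists>B\<in>P. x \<in> B" for x using P(1) by (auto simp: partition_on_def)
  have uniq: "A = B" if "A \<in> P" "B \<in> P" "x \<in> A" "x \<in> B" for A B x
    using P(1) that by (auto simp: partition_on_def disjoint_def)
  have eq: "equivp R"
  proof (rule equivpI)
    show "reflp R" using ex by (auto simp: R_def reflp_def)
    show "symp R" by (auto simp: R_def symp_def)
    show "transp R"
    proof (rule transpI)
      fix x y z assume "R x y" "R y z"
      then obtain A B where "A \<in> P" "x \<in> A" "y \<in> A" "B \<in> P" "y \<in> B" "z \<in> B" by (auto simp: R_def)
      moreover from this have "A = B" using uniq by blast
      ultimately show "R x z" by (auto simp: R_def)
    qed
  qed
  have the: "(THE B. B \<in> P \<and> x \<in> B) = B" if "B \<in> P" "x \<in> B" for x B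
    using that uniq by (intro the_equality) auto
  have val: "u x = (if x = Min B then Max B else Max {y \<in> B. y < x})" if "B \<in> P" "x \<in> B" for x B
    using the[OF that] by (simp add: u partition_perm_def Let_def)
  have key: "R x (u x) \<and> (u x < x \<longrightarrow> R x y \<and> y < x \<longrightarrow> y \<le> u x) \<and>
      (x \<le> u x \<longrightarrow> R x y \<longrightarrow> x \<le> y \<and> y \<le> u x)" for x y
  proof -
    obtain B where B: "B \<in> P" "x \<in> B" using ex by blast
    have RB: "R x z \<longleftrightarrow> z \<in> B" for z using B uniq by (auto simp: R_def)
    show ?thesis
    proof (cases "x = Min B")
      case True
      then have "u x = Max B" using val[OF B] by simp
      moreover have "Max B \<in> B" using B by (intro Max_in) auto
      moreover have "y \<in> B \<Longrightarrow> y \<le> Max B" "y \<in> B \<Longrightarrow> Min B \<le> y" by auto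
      ultimately show ?thesis using True RB by auto
    next
      case False
      let ?S = "{y \<in> B. y < x}"
      have "Min B \<in> B" "Min B \<le> x" using B by (auto intro: Min_in)
      then have ne: "?S \<noteq> {}" using False by force
      have "u x = Max ?S" using val[OF B] False by simp
      moreover have "Max ?S \<in> ?S" using ne by (intro Max_in) auto
      moreover have "y \<in> ?S \<Longrightarrow> y \<le> Max ?S" by auto
      ultimately show ?thesis using RB by auto
    qed
  qed
  have nc: "R a b" if o: "a < b" "b < c" "c < d" and R: "R a c" "R b d" for a b c d
  proof -
    obtain A B where A: "A \<in> P" "a \<in> A" "c \<in> A" and B: "B \<in> P" "b \<in> B" "d \<in> B"
      using R by (auto simp: R_def)
    then have "A = B" using P(2) o unfolding noncrossing_def by blast
    then show ?thesis using A B by (auto simp: R_def)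
  qed
  have "nc_rel u R" unfolding nc_rel_def using eq key nc by blast
  then show ?thesis by (rule that)
qed

lemma nc_rel_inj:
  assumes "nc_rel u R" shows "inj u"
proof -
  have False if "u x = u y" "x < y" for x y
    
  proof -
    have R: "R y x"
      using nc_relD(2,3)[OF assms] nc_relD(4)[OF assms, of x] nc_relD(4)[OF assms, of y] that(1) by metis
    then have "u y < y" using nc_relD(6)[OF assms, of y x] that(2) by (meson leD leI)
    moreover from this have "x \<le> u y" using nc_relD(5)[OF assms _ R that(2)] by blast
    ultimately show False
      using nc_relD(7)[OF assms, of x y] nc_relD(2)[OF assms R] that(1) by auto
  qed
  then show ?thesis by (metis injI linorder_neqE)
qed

lemma NC_bij: "w \<in> (NC :: ('n::{finite,linorder} \<Rightarrow> 'n) set) \<Longrightarrow> bij w"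
  using NC_nc_rel[of w] nc_rel_inj[of w] finite_UNIV_inj_surj[of w] unfolding bij_def by auto

text \<open>With \<open>a\<close> and \<open>b\<close> the positions of the values \<open>i\<close>
  and \<open>j\<close>, the transposition swaps two arrows: \<open>w' a = j\<close> and
  \<open>w' b = i\<close>. The constraints below come mainly from reading these arrows in the
  noncrossing relation of \<open>w'\<close>.\<close>

locale NC_inversion =
  fixes w w' :: "'n::{finite,linorder} \<Rightarrow> 'n" and R R' and i j a b :: 'n
  assumes w: "nc_rel w R" and w': "nc_rel w' R'"
    and w'_def: "w' = Transposition.transpose i j \<circ> w"
    and ij: "i < j" and ba: "b < a" and wa: "w a = i" and wb: "w b = j"
begin

lemma w'a: "w' a = j" and w'b: "w' b = i" using w'_def wa wb by auto

lemma w'_other: "x \<noteq> a \<Longrightarrow> x \<noteq> b \<Longrightarrow> w' x = w x"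
  using nc_rel_inj[OF w] wa wb w'_def by (auto simp: inj_eq transpose_def)

text \<open>Since \<open>w b = j\<close>, this makes \<open>b\<close> and \<open>j\<close> the
  extremes of one block of \<open>w\<close>. Otherwise the pairs \<open>i, b\<close> and
  \<open>j, a\<close> cross in \<open>R'\<close>, so all four share a block and \<open>b\<close>
  lies strictly between \<open>a\<close> and its predecessor \<open>j\<close>.\<close>

lemma upper_is_max: "b \<le> j"
proof (rule ccontr)
  assume "\<not> b \<le> j"
  then have o: "i < j" "j < b" "b < a" using ij ba by auto
  have r: "R' a j" "R' b i" using nc_relD(4)[OF w'] w'a w'b by metis+
  have "R' i j" using nc_relD(8)[OF w' o] r nc_relD(2)[OF w'] by blast
  then have "R' a b" using r nc_relD(2,3)[OF w'] by blast
  then have "b \<le> w' a" using nc_relD(5)[OF w', of a b] o w'a by auto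
  then show False using o w'a by auto
qed

text \<open>Hence \<open>i\<close> is the predecessor of \<open>a\<close> in its block. If
  \<open>a \<le> i\<close>, both arrows of \<open>w'\<close> go up, so \<open>a\<close> and
  \<open>b\<close> are minima of their blocks in \<open>R'\<close>; noncrossing puts them into one
  block, which would have two minima.\<close>

lemma lower_not_max: "i < a"
proof (rule ccontr)
  assume "\<not> i < a"
  then have o: "a \<le> i" by auto
  have r: "R' a j" "R' b i" using nc_relD(4)[OF w'] w'a w'b by metis+
  have m: "R' a x \<Longrightarrow> a \<le> x" "R' b x \<Longrightarrow> b \<le> x" for x
    using nc_relD(6)[OF w'] w'a w'b o ij ba by auto
  have "R' b a"
  proof (cases "a = i")
    case False then show ?thesis using nc_relD(8)[OF w' ba _ ij] o r by auto
  qed (use r in auto)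
  then show False using m ba nc_relD(2)[OF w'] by (meson leD)
qed

text \<open>Walking down the block of \<open>j\<close> by \<open>w\<close> ends at its minimum
  \<open>b\<close>. The walk avoids \<open>a\<close>, which lies in the block of \<open>i\<close>,
  so \<open>w'\<close> takes the same steps.\<close>

lemma block_merged:
  assumes "\<not> R i j" shows "R j x \<Longrightarrow> R' b x"
proof (induction "card {..<x}" arbitrary: x rule: less_induct)
  case less
  have Rjb: "R j b" using nc_relD(2,4)[OF w] wb by metis
  have Rxb: "R x b" using less.prems Rjb nc_relD(2,3)[OF w] by blast
  have xa: "x \<noteq> a" using assms less.prems nc_relD(2,3,4)[OF w] wa by metis
  show ?case
  proof (cases "x = b")
    case True then show ?thesis using nc_relD(1)[OF w'] by simp
  next
    case False
    then have "b < x" using nc_relD(6)[OF w, of b x] upper_is_max wb Rxb nc_relD(2)[OF w]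
      by (metis order_le_neq_trans)
    then have "w x < x" using nc_relD(6)[OF w, of x b] Rxb by (meson leD not_le_imp_less)
    moreover have "R j (w x)" using less.prems nc_relD(3,4)[OF w] by blast
    moreover have "card {..<w x} < card {..<x}"
      using \<open>w x < x\<close> by (intro psubset_card_mono) auto
    ultimately have "R' b (w x)" using less.hyps by blast
    then show ?thesis using w'_other[OF xa False] nc_relD(2,3,4)[OF w'] by metis
  qed
qed

text \<open>The block of \<open>j\<close> fits into the gap between \<open>i\<close> and the next
  element \<open>a\<close> of its block. In the merged block of \<open>w'\<close> an upward arrow
  runs from the minimum to the maximum, but \<open>b < a\<close> forbids \<open>a\<close> as minimum
  and \<open>i < a\<close> forbids \<open>i\<close> as maximum.\<close>

lemma nested:
  assumes nR: "\<not> R i j" shows "i < b" "j < a"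
proof -
  have r: "R' a j" "R' b i" using nc_relD(4)[OF w'] w'a w'b by metis+
  have bj: "R' b j" using block_merged[OF nR] nc_relD(1)[OF w] by blast
  have aj: "a \<noteq> j" using lower_not_max nR wa nc_relD(2,4)[OF w] by metis
  have ib: "i \<noteq> b" using wb nR nc_relD(4)[OF w] by metis
  have ab: "R' a b" using bj r nc_relD(2,3)[OF w'] by blast
  show ja: "j < a"
  proof (rule ccontr)
    assume "\<not> j < a"
    then have "a \<le> w' a" using w'a by auto
    then show False using nc_relD(6)[OF w' _ ab] ba by auto
  qed
  show "i < b"
  proof (rule ccontr)
    assume "\<not> i < b"
    then have "b \<le> w' b" using w'b by auto
    then have "a \<le> i" using nc_relD(7)[OF w', of b a] ab nc_relD(2)[OF w'] w'b by metis
    then show False using lower_not_max by auto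
  qed
qed

end

lemma Inv_NC_locale:
  assumes "w \<in> NC" "(i, j) \<in> Inv_NC w" "nc_rel w R"
  obtains R' where "NC_inversion w (Transposition.transpose i j \<circ> w) R R' i j (inv_into UNIV w i) (inv_into UNIV w j)"
proof -
  have m: "Transposition.transpose i j \<circ> w \<in> NC" "i < j" "inv_into UNIV w j < inv_into UNIV w i"
    using assms(2) by (auto simp: Inv_NC_def)
  obtain R' where "nc_rel (Transposition.transpose i j \<circ> w) R'" using NC_nc_rel[OF m(1)] .
  then have "NC_inversion w (Transposition.transpose i j \<circ> w) R R' i j (inv_into UNIV w i) (inv_into UNIV w j)"
    using assms(3) m NC_bij[OF assms(1)] by unfold_locales (auto simp: bij_is_surj surj_f_inv_f)
  then show ?thesis by (rule that)
qed

text \<open>As the larger entry of an inversion, \<open>i\<close> is at least its position; as the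
  smaller entry, it is below its position.\<close>

lemma Inv_NC_no_chain:
  assumes "w \<in> NC" "(i, j) \<in> Inv_NC w" shows "(h, i) \<notin> Inv_NC w"
proof
  assume h: "(h, i) \<in> Inv_NC w"
  obtain R where R: "nc_rel w R" using NC_nc_rel[OF assms(1)] .
  have "i < inv_into UNIV w i"
    by (rule Inv_NC_locale[OF assms R]) (rule NC_inversion.lower_not_max)
  moreover have "inv_into UNIV w i \<le> i"
    by (rule Inv_NC_locale[OF assms(1) h R]) (rule NC_inversion.upper_is_max)
  ultimately show False by auto
qed

text \<open>Positions are columns, so this bounds the rows that the column of \<open>j\<close>
  shares with earlier columns; it is the source of the forest condition.\<close>

lemma Inv_NC_shared_unique:
  assumes w: "w \<in> NC" and s: "(s, j) \<in> Inv_NC w" "(s, k) \<in> Inv_NC w" "inv_into UNIV w k < inv_into UNIV w j"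
    and s': "(s', j) \<in> Inv_NC w" "(s', k') \<in> Inv_NC w" "inv_into UNIV w k' < inv_into UNIV w j"
  shows "s = s'"
proof -
  obtain R where R: "nc_rel w R" using NC_nc_rel[OF w] .
  have surj: "w (inv_into UNIV w x) = x" for x by (rule surj_f_inv_f[OF bij_is_surj[OF NC_bij[OF w]]])
  \<comment> \<open>If \<open>s\<close> is in the block of \<open>j\<close>, the position of
    \<open>j\<close>, being the block minimum, is at most \<open>s\<close>. A \<open>k\<close> in
    the same block would have the same position; a \<open>k\<close> in another block is nested above
    \<open>s\<close>, so its column comes after that of \<open>j\<close>.\<close>
  have outside: "\<not> R s j" if h: "(s, j) \<in> Inv_NC w" "(s, k) \<in> Inv_NC w" "inv_into UNIV w k < inv_into UNIV w j" for s k
  proof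
    assume sj: "R s j"
    obtain R1 where 1: "NC_inversion w (Transposition.transpose s j \<circ> w) R R1 s j (inv_into UNIV w s) (inv_into UNIV w j)"
      using Inv_NC_locale[OF w h(1) R] .
    obtain R2 where 2: "NC_inversion w (Transposition.transpose s k \<circ> w) R R2 s k (inv_into UNIV w s) (inv_into UNIV w k)"
      using Inv_NC_locale[OF w h(2) R] .
    have Rinv: "R x (inv_into UNIV w x)" for x using nc_relD(2)[OF R nc_relD(4)[OF R, of "inv_into UNIV w x"]] surj by simp
    have min: "inv_into UNIV w y \<le> x" if m: "inv_into UNIV w y \<le> y" "R y x" for x y
      using nc_relD(6)[OF R, of "inv_into UNIV w y" x] m surj[of y] nc_relD(3)[OF R nc_relD(2)[OF R Rinv[of y]] m(2)] by simp
    note min = min[OF NC_inversion.upper_is_max[OF 1]] min[OF NC_inversion.upper_is_max[OF 2]]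
    show False
    proof (cases "R s k")
      case True
      then have "R k j" using sj nc_relD(2,3)[OF R] by blast
      then have "R k (inv_into UNIV w j)" "R j (inv_into UNIV w k)" using Rinv nc_relD(2,3)[OF R] by blast+
      then show False using min h(3) by (meson leD)
    next
      case False
      then have "s < inv_into UNIV w k" using NC_inversion.nested[OF 2] by blast
      moreover have "inv_into UNIV w j \<le> s" using min(1) sj nc_relD(2)[OF R] by blast
      ultimately show False using h(3) by auto
    qed
  qed
  \<comment> \<open>Both rows lie below the block of \<open>j\<close>. In \<open>w1\<close> the
    value \<open>s\<close> and the position of \<open>j\<close> share a block. The pair of
    \<open>s'\<close> and its position crosses them, so \<open>s'\<close> joins that block, strictly
    between the position of \<open>j\<close> and its predecessor \<open>s\<close>.\<close>
  have no: False if h: "(s, j) \<in> Inv_NC w" "(s', j) \<in> Inv_NC w" "\<not> R s j" "\<not> R s' j" "s < s'" for s s'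
  proof -
    obtain R1 where "NC_inversion w (Transposition.transpose s j \<circ> w) R R1 s j (inv_into UNIV w s) (inv_into UNIV w j)"
      using Inv_NC_locale[OF w h(1) R] .
    then interpret A: NC_inversion w "Transposition.transpose s j \<circ> w" R R1 s j "inv_into UNIV w s" "inv_into UNIV w j" .
    obtain R2 where "NC_inversion w (Transposition.transpose s' j \<circ> w) R R2 s' j (inv_into UNIV w s') (inv_into UNIV w j)"
      using Inv_NC_locale[OF w h(2) R] .
    then interpret B: NC_inversion w "Transposition.transpose s' j \<circ> w" R R2 s' j "inv_into UNIV w s'" "inv_into UNIV w j" .
    define w1 where "w1 = Transposition.transpose s j \<circ> w"
    note w1 = A.w'[folded w1_def]
    note n = A.nested[OF h(3)] B.nested[OF h(4)]
    have "inv_into UNIV w s' \<noteq> inv_into UNIV w s"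
      using arg_cong[of "inv_into UNIV w s'" "inv_into UNIV w s" w] h(5) unfolding surj by (metis less_irrefl)
    moreover have "inv_into UNIV w s' \<noteq> inv_into UNIV w j" using B.ba by (rule less_imp_neq[symmetric])
    ultimately have "w1 (inv_into UNIV w s') = w (inv_into UNIV w s')" unfolding w1_def by (rule A.w'_other)
    then have "w1 (inv_into UNIV w s') = s'" unfolding surj .
    then have c: "R1 s' (inv_into UNIV w s')"
      using nc_relD(2)[OF w1 nc_relD(4)[OF w1, of "inv_into UNIV w s'"]] by simp
    have wb: "w1 (inv_into UNIV w j) = s" unfolding w1_def by (rule A.w'b)
    then have b: "R1 s (inv_into UNIV w j)"
      using nc_relD(2)[OF w1 nc_relD(4)[OF w1, of "inv_into UNIV w j"]] by simp
    have "R1 s s'" by (rule nc_relD(8)[OF w1 h(5) n(3) B.ba b c])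
    then have "R1 (inv_into UNIV w j) s'" by (rule nc_relD(3)[OF w1 nc_relD(2)[OF w1 b]])
    moreover have "w1 (inv_into UNIV w j) < inv_into UNIV w j" using n(1) wb by simp
    ultimately have "s' \<le> w1 (inv_into UNIV w j)" using nc_relD(5)[OF w1] n(3) by simp
    then show False using wb h(5) by simp
  qed
  show ?thesis
  proof (rule linorder_cases[of s s'])
    assume "s < s'"
    then show ?thesis using no[OF s(1) s'(1) outside[OF s] outside[OF s']] by blast
  next
    assume "s' < s"
    then show ?thesis using no[OF s'(1) s(1) outside[OF s'] outside[OF s]] by blast
  qed
qed

subsection \<open>Coordinate bases of a subspace\<close>

definition injective_coords :: "'n set \<Rightarrow> ('n::finite) cvec set \<Rightarrow> bool" where
  "injective_coords I V \<longleftrightarrow> (\<forall>v\<in>V. (\<forall>i\<in>I. v $ i = 0) \<longrightarrow> v = 0)"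

definition matroid_bases :: "('n::finite) cvec set \<Rightarrow> 'n set set" where
  "matroid_bases V = {I. card I = vec.dim V \<and> injective_coords I V}"

definition coord_subspace :: "'n set \<Rightarrow> ('n::finite) cvec set" where
  "coord_subspace I = {v. \<forall>i. i \<notin> I \<longrightarrow> v $ i = 0}"

lemma subspace_coord_subspace: "vec.subspace (coord_subspace I)"
  by (auto simp: vec.subspace_def coord_subspace_def)

lemma span_axis: "vec.span ((\<lambda>i. axis i 1 :: ('n::finite) cvec) ` I) = coord_subspace I"
proof
  show "vec.span ((\<lambda>i. axis i 1 :: 'n cvec) ` I) \<subseteq> coord_subspace I"
    by (rule vec.span_minimal[OF _ subspace_coord_subspace]) (auto simp: coord_subspace_def axis_def)
  show "coord_subspace I \<subseteq> vec.span ((\<lambda>i. axis i 1 :: 'n cvec) ` I)"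
  proof
    fix v :: "'n cvec" assume v: "v \<in> coord_subspace I"
    have "v = (\<Sum>i\<in>UNIV. v $ i *s axis i 1)" by (simp add: basis_expansion)
    also have "\<dots> = (\<Sum>i\<in>I. v $ i *s axis i 1)"
      using v by (intro sum.mono_neutral_right) (auto simp: coord_subspace_def)
    also have "\<dots> \<in> vec.span ((\<lambda>i. axis i 1 :: 'n cvec) ` I)"
      by (intro vec.span_sum vec.span_scale vec.span_base) auto
    finally show "v \<in> vec.span ((\<lambda>i. axis i 1 :: 'n cvec) ` I)" .
  qed
qed

lemma dim_coord_subspace: "vec.dim (coord_subspace I :: ('n::finite) cvec set) = card I"
proof -
  let ?B = "(\<lambda>i. axis i 1 :: 'n cvec) ` I"
  have inj: "inj_on (\<lambda>i. axis i 1 :: 'n cvec) I" by (auto simp: inj_on_def axis_eq_axis)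
  have "?B \<subseteq> cart_basis" by (auto simp: cart_basis_def)
  then have "vec.independent ?B" by (meson vec.independent_mono independent_cart_basis)
  then have "vec.dim (vec.span ?B) = card ?B" unfolding vec.dim_span by (rule vec.dim_eq_card_independent)
  then show ?thesis using inj by (simp add: span_axis card_image)
qed

lemma injective_coordsD: "injective_coords I V \<Longrightarrow> v \<in> V \<Longrightarrow> (\<And>i. i \<in> I \<Longrightarrow> v $ i = 0) \<Longrightarrow> v = 0"
  unfolding injective_coords_def by blast

lemma injective_coords_eqI:
  assumes "vec.subspace V" "injective_coords I V" "u \<in> V" "v \<in> V" "\<And>i. i \<in> I \<Longrightarrow> u $ i = v $ i"
  shows "u = v"
  using assms vec.subspace_diff[of V u v] unfolding injective_coords_def by fastforce

lemma matroid_basis_surj: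
  fixes V :: "('n::finite) cvec set"
  assumes V: "vec.subspace V" and I: "I \<in> matroid_bases V"
  obtains v where "v \<in> V" "\<And>i. i \<in> I \<Longrightarrow> v $ i = f i"
proof -
  define p where "p v = (\<chi> i. if i \<in> I then v $ i else 0)" for v :: "'n cvec"
  have p: "p v $ i = v $ i" if "i \<in> I" for v i using that by (simp add: p_def)
  have lin: "Vector_Spaces.linear (*s) (*s) p"
    by unfold_locales (auto simp: p_def Finite_Cartesian_Product.vec_eq_iff)
  have "inj_on p V"
  proof (rule inj_onI)
    fix u v assume uv: "u \<in> V" "v \<in> V" "p u = p v"
    have "u $ i = v $ i" if "i \<in> I" for i
      using p[OF that, of u] p[OF that, of v] uv(3) by simp
    then show "u = v"
      using I uv by (intro injective_coords_eqI[OF V]) (auto simp: matroid_bases_def)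
  qed
  then have "vec.dim (p ` V) = vec.dim V"
    using V by (intro vec.dim_image_eq[OF lin]) (simp add: vec.span_eq_iff[THEN iffD2])
  then have "vec.dim (p ` V) = card I" using I by (simp add: matroid_bases_def)
  then have "p ` V = coord_subspace I"
    by (intro vec.subspace_dim_equal vec.linear_subspace_image[OF lin V] subspace_coord_subspace)
      (auto simp: dim_coord_subspace, auto simp: p_def coord_subspace_def)
  moreover have "(\<chi> i. if i \<in> I then f i else 0) \<in> coord_subspace I" by (simp add: coord_subspace_def)
  ultimately have "(\<chi> i. if i \<in> I then f i else 0) \<in> p ` V" by simp
  then obtain v where v: "(\<chi> i. if i \<in> I then f i else 0) = p v" "v \<in> V" by (rule imageE)
  have "v $ i = f i" if "i \<in> I" for i
    using p[OF that, of v] that v(1)[symmetric] by simp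
  with v(2) show ?thesis by (rule that)
qed

section \<open>Fundamental vectors: the reduced echelon form with respect to a basis\<close>

definition fund_vec :: "('n::finite) cvec set \<Rightarrow> 'n set \<Rightarrow> 'n \<Rightarrow> 'n cvec" where
  "fund_vec V I j = (THE v. v \<in> V \<and> (\<forall>i\<in>I. v $ i = (if i = j then 1 else 0)))"

lemma fund_vec:
  assumes V: "vec.subspace V" and I: "I \<in> matroid_bases V"
  shows "fund_vec V I j \<in> V" "i \<in> I \<Longrightarrow> fund_vec V I j $ i = (if i = j then 1 else 0)"
    "\<And>v. v \<in> V \<Longrightarrow> (\<And>i. i \<in> I \<Longrightarrow> v $ i = (if i = j then 1 else 0)) \<Longrightarrow> fund_vec V I j = v"
proof -
  have uniq: "u = v" if "u \<in> V" "v \<in> V" "\<forall>i\<in>I. u $ i = (if i = j then 1 else 0)"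
    "\<forall>i\<in>I. v $ i = (if i = j then 1 else 0)" for u v
    using that I by (intro injective_coords_eqI[OF V]) (auto simp: matroid_bases_def)
  obtain v where "v \<in> V" "\<And>i. i \<in> I \<Longrightarrow> v $ i = (if i = j then 1 else 0)"
    using matroid_basis_surj[OF V I, of "\<lambda>i. if i = j then 1 else 0"] by blast
  then have "\<exists>!v. v \<in> V \<and> (\<forall>i\<in>I. v $ i = (if i = j then 1 else 0))" using uniq by blast
  from theI'[OF this] have *: "fund_vec V I j \<in> V \<and> (\<forall>i\<in>I. fund_vec V I j $ i = (if i = j then 1 else 0))"
    unfolding fund_vec_def .
  then show "fund_vec V I j \<in> V" "i \<in> I \<Longrightarrow> fund_vec V I j $ i = (if i = j then 1 else 0)" by blast+
  show "fund_vec V I j = v" if "v \<in> V" "\<And>i. i \<in> I \<Longrightarrow> v $ i = (if i = j then 1 else 0)" for v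
    using uniq * that by blast
qed

lemma fund_vec_expansion:
  fixes V :: "('n::finite) cvec set"
  assumes V: "vec.subspace V" and I: "I \<in> matroid_bases V" and v: "v \<in> V"
  shows "v = (\<Sum>j\<in>I. v $ j *s fund_vec V I j)"
proof (rule injective_coords_eqI[OF V _ v])
  show "injective_coords I V" using I by (simp add: matroid_bases_def)
  show "(\<Sum>j\<in>I. v $ j *s fund_vec V I j) \<in> V"
    using V fund_vec(1)[OF V I] by (intro vec.subspace_sum vec.subspace_scale)
  fix i assume i: "i \<in> I"
  have "(\<Sum>j\<in>I. v $ j *s fund_vec V I j) $ i = (\<Sum>j\<in>I. if i = j then v $ j else 0)"
    unfolding sum_component by (intro sum.cong refl) (simp add: fund_vec(2)[OF V I i])
  also have "\<dots> = v $ i" using i by simp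
  finally show "v $ i = (\<Sum>j\<in>I. v $ j *s fund_vec V I j) $ i" by (rule sym)
qed

lemma span_fund_vec:
  fixes V :: "('n::finite) cvec set"
  assumes V: "vec.subspace V" and I: "I \<in> matroid_bases V"
  shows "vec.span (fund_vec V I ` I) = V"
proof
  show "vec.span (fund_vec V I ` I) \<subseteq> V"
    using fund_vec(1)[OF V I] V by (intro vec.span_minimal) auto
  show "V \<subseteq> vec.span (fund_vec V I ` I)"
  proof
    fix v assume v: "v \<in> V"
    have "(\<Sum>j\<in>I. v $ j *s fund_vec V I j) \<in> vec.span (fund_vec V I ` I)"
      by (intro vec.span_sum vec.span_scale vec.span_base imageI)
    then show "v \<in> vec.span (fund_vec V I ` I)" using fund_vec_expansion[OF V I v] by argo
  qed
qed

text \<open>If the entry vanishes, the fundamental vector itself vanishes on the exchanged set; if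
  not, a vector vanishing on that set is a zero multiple of it. So the matroid determines the zero
  pattern of each echelon form.\<close>

lemma basis_exchange_iff:
  fixes V :: "('n::finite) cvec set"
  assumes V: "vec.subspace V" and I: "I \<in> matroid_bases V" and j: "j \<in> I" and k: "k \<notin> I"
  shows "fund_vec V I j $ k \<noteq> 0 \<longleftrightarrow> insert k (I - {j}) \<in> matroid_bases V"
proof -
  have fin: "finite I" by simp
  have card: "card (insert k (I - {j})) = vec.dim V"
    using I k card_Suc_Diff1[OF fin j] by (simp add: matroid_bases_def)
  have fj: "fund_vec V I j $ j = 1" using fund_vec(2)[OF V I j] by simp
  show ?thesis
  proof
    assume nz: "fund_vec V I j $ k \<noteq> 0"
    have "v = 0" if v: "v \<in> V" "\<forall>i\<in>insert k (I - {j}). v $ i = 0" for v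
    proof -
      have eq: "v = v $ j *s fund_vec V I j"
        using v I by (intro injective_coords_eqI[OF V _ v(1)] vec.subspace_scale[OF V] fund_vec(1)[OF V I])
          (auto simp: matroid_bases_def fund_vec(2)[OF V I])
      have "v $ j * fund_vec V I j $ k = 0"
        using arg_cong[OF eq, of "\<lambda>u. u $ k"] v(2) by simp
      then have "v $ j = 0" using nz by simp
      then show ?thesis using eq by (metis vec.scale_zero_left)
    qed
    then show "insert k (I - {j}) \<in> matroid_bases V"
      using card by (simp add: matroid_bases_def injective_coords_def)
  next
    assume "insert k (I - {j}) \<in> matroid_bases V"
    then have inj: "injective_coords (insert k (I - {j})) V" by (simp add: matroid_bases_def)
    show "fund_vec V I j $ k \<noteq> 0"
    proof
      assume "fund_vec V I j $ k = 0"
      then have "\<forall>i\<in>insert k (I - {j}). fund_vec V I j $ i = 0" by (simp add: fund_vec(2)[OF V I])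
      then have "fund_vec V I j = 0"
        using inj fund_vec(1)[OF V I] unfolding injective_coords_def by blast
      then show False using fj by simp
    qed
  qed
qed

subsection \<open>The torus action\<close>

definition dscale :: "('n::finite) cvec \<Rightarrow> 'n cvec \<Rightarrow> 'n cvec" where
  "dscale t v = (\<chi> i. t $ i * v $ i)"

lemma dscale_nth [simp]: "dscale t v $ i = t $ i * v $ i"
  by (simp add: dscale_def)

lemma torus_act_dscale: "torus_act t V = dscale t ` V"
  by (simp add: torus_act_def dscale_def)

lemma linear_dscale: "Vector_Spaces.linear (*s) (*s) (dscale t)"
  by unfold_locales (auto simp: Finite_Cartesian_Product.vec_eq_iff algebra_simps)

lemma inj_dscale: "t \<in> torus \<Longrightarrow> inj (dscale t)"
  by (rule injI) (auto simp: Finite_Cartesian_Product.vec_eq_iff torus_def)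

lemma torus_act_mult: "torus_act s (torus_act t V) = torus_act (dscale s t) V"
  by (auto simp: torus_act_dscale image_image dscale_def mult.assoc)

lemma torus_mult: "s \<in> torus \<Longrightarrow> t \<in> torus \<Longrightarrow> dscale s t \<in> torus"
  by (simp add: torus_def)

definition torus_inv :: "('n::finite) cvec \<Rightarrow> 'n cvec" where
  "torus_inv t = (\<chi> i. inverse (t $ i))"

lemma torus_inv: "t \<in> torus \<Longrightarrow> torus_inv t \<in> torus"
  by (simp add: torus_def torus_inv_def)

lemma torus_act_inv:
  assumes "t \<in> torus"
  shows "torus_act (torus_inv t) (torus_act t V) = V" "torus_act t (torus_act (torus_inv t) V) = V"
proof -
  have 1: "torus_act u V = V" if "\<And>i. u $ i = 1" for u
  proof -
    have "dscale u v = v" for v by (simp add: Finite_Cartesian_Product.vec_eq_iff that)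
    then show ?thesis by (simp add: torus_act_dscale)
  qed
  show "torus_act (torus_inv t) (torus_act t V) = V" "torus_act t (torus_act (torus_inv t) V) = V"
    unfolding torus_act_mult using assms by (intro 1; simp add: torus_def torus_inv_def)+
qed

lemma torus_act_span: "torus_act t (vec.span S) = vec.span (dscale t ` S)"
  unfolding torus_act_dscale by (rule vec.linear_span_image[OF linear_dscale, symmetric])

lemma subspace_torus_act: "vec.subspace V \<Longrightarrow> vec.subspace (torus_act t V)"
  unfolding torus_act_dscale by (rule vec.linear_subspace_image[OF linear_dscale])

lemma dim_torus_act: "t \<in> torus \<Longrightarrow> vec.dim (torus_act t V) = vec.dim V"
  unfolding torus_act_dscale
  by (rule vec.dim_image_eq[OF linear_dscale]) (rule inj_on_subset[OF inj_dscale subset_UNIV])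

lemma Gr_torus_act: "t \<in> torus \<Longrightarrow> V \<in> Gr r \<Longrightarrow> torus_act t V \<in> Gr r"
  by (simp add: Gr_def subspace_torus_act dim_torus_act)

lemma injective_coords_torus_act:
  assumes "t \<in> torus" shows "injective_coords I (torus_act t V) = injective_coords I V"
proof -
  have "dscale t v = 0 \<longleftrightarrow> v = 0" "dscale t v $ i = 0 \<longleftrightarrow> v $ i = 0" for v i
    using assms by (simp_all add: Finite_Cartesian_Product.vec_eq_iff torus_def)
  then show ?thesis by (simp add: injective_coords_def torus_act_dscale)
qed

lemma matroid_bases_torus_act: "t \<in> torus \<Longrightarrow> matroid_bases (torus_act t V) = matroid_bases V"
  by (simp add: matroid_bases_def dim_torus_act injective_coords_torus_act)

subsection \<open>Ordered forests of vectors\<close>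

definition shared_rows :: "'a::linorder set \<Rightarrow> ('a \<Rightarrow> ('n::finite) cvec) \<Rightarrow> 'a \<Rightarrow> 'n set" where
  "shared_rows C v c = {s. v c $ s \<noteq> 0 \<and> (\<exists>d\<in>C. d < c \<and> v d $ s \<noteq> 0)}"

text \<open>Each vector meets the union of the supports of its predecessors in at most one row, so the
  bipartite support graph is a forest.\<close>

definition order_forest :: "'a::linorder set \<Rightarrow> ('a \<Rightarrow> ('n::finite) cvec) \<Rightarrow> bool" where
  "order_forest C v \<longleftrightarrow> (\<forall>c\<in>C. \<forall>s\<in>shared_rows C v c. \<forall>s'\<in>shared_rows C v c. s = s')"

lemma order_forest_mono: "order_forest C v \<Longrightarrow> D \<subseteq> C \<Longrightarrow> order_forest D v"
  unfolding order_forest_def shared_rows_def by blast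

text \<open>Vectors are added in increasing order. The new one shares at most one row with its
  predecessors: its own scalar corrects that entry, and the other rows of its support are still free
  for the torus.\<close>

lemma order_forest_scaling:
  fixes u v :: "'a::linorder \<Rightarrow> ('n::finite) cvec"
  assumes "finite C" "order_forest C v" "\<And>c k. c \<in> C \<Longrightarrow> u c $ k = 0 \<longleftrightarrow> v c $ k = 0"
  shows "\<exists>\<sigma>\<in>torus. \<exists>\<tau>. (\<forall>c\<in>C. \<tau> c \<noteq> 0) \<and> (\<forall>c\<in>C. u c = \<tau> c *s dscale \<sigma> (v c))"
  using assms
proof (induction C rule: finite_linorder_max_induct)
  case empty
  have "(\<chi> i. 1) \<in> torus" by (simp add: torus_def)
  then show ?case by auto
next
  case (insert b A)
  have "order_forest A v" using order_forest_mono[OF insert.prems(1)] by blast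
  moreover have "\<And>c k. c \<in> A \<Longrightarrow> u c $ k = 0 \<longleftrightarrow> v c $ k = 0" using insert.prems(2) by blast
  ultimately obtain \<sigma> \<tau> where \<sigma>: "\<sigma> \<in> torus" and \<tau>: "\<And>c. c \<in> A \<Longrightarrow> \<tau> c \<noteq> 0"
    and eq: "\<And>c. c \<in> A \<Longrightarrow> u c = \<tau> c *s dscale \<sigma> (v c)"
    using insert.IH by blast
  have \<sigma>0: "\<sigma> $ k \<noteq> 0" for k using \<sigma> by (simp add: torus_def)
  have supp: "u b $ k = 0 \<longleftrightarrow> v b $ k = 0" for k using insert.prems(2) by blast
  define S where "S = shared_rows (insert b A) v b"
  have S1: "s = s'" if "s \<in> S" "s' \<in> S" for s s'
    using insert.prems(1) that unfolding order_forest_def S_def by blast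
  have S0: "v b $ s \<noteq> 0" if "s \<in> S" for s using that by (simp add: S_def shared_rows_def)
  have S2: "k \<in> S" if "v b $ k \<noteq> 0" "c \<in> A" "v c $ k \<noteq> 0" for c k
    using that insert.hyps(2) by (auto simp: S_def shared_rows_def)
  obtain t where t: "t \<noteq> 0" "\<And>s. s \<in> S \<Longrightarrow> u b $ s = \<sigma> $ s * t * v b $ s"
  proof (cases "S = {}")
    case True then show ?thesis using that[of 1] by simp
  next
    case False
    then obtain s where s: "s \<in> S" by blast
    show ?thesis
    proof (rule that[of "u b $ s / (\<sigma> $ s * v b $ s)"])
      show "u b $ s / (\<sigma> $ s * v b $ s) \<noteq> 0" using S0[OF s] supp[of s] \<sigma>0[of s] by simp
      show "u b $ s' = \<sigma> $ s' * (u b $ s / (\<sigma> $ s * v b $ s)) * v b $ s'" if "s' \<in> S" for s'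
        using S1[OF s that] S0[OF s] \<sigma>0[of s] by simp
    qed
  qed
  define \<sigma>' where "\<sigma>' = (\<chi> k. if v b $ k \<noteq> 0 \<and> k \<notin> S then u b $ k / (t * v b $ k) else \<sigma> $ k)"
  have "\<sigma>' \<in> torus" using t(1) \<sigma>0 supp by (simp add: \<sigma>'_def torus_def)
  moreover have "\<forall>c\<in>insert b A. (\<tau>(b := t)) c \<noteq> 0" using \<tau> t(1) by simp
  moreover have "u c = (\<tau>(b := t)) c *s dscale \<sigma>' (v c)" if c: "c \<in> insert b A" for c
  proof (cases "c = b")
    case True
    have "u b $ k = t * (\<sigma>' $ k * v b $ k)" for k
      using t supp[of k] by (cases "k \<in> S") (auto simp: \<sigma>'_def)
    then show ?thesis using True by (simp add: Finite_Cartesian_Product.vec_eq_iff)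
  next
    case False
    then have cA: "c \<in> A" using c by simp
    have "\<sigma>' $ k * v c $ k = \<sigma> $ k * v c $ k" for k
      using S2[OF _ cA, of k] by (auto simp: \<sigma>'_def)
    then have "dscale \<sigma>' (v c) = dscale \<sigma> (v c)" by (simp add: Finite_Cartesian_Product.vec_eq_iff)
    then show ?thesis using False eq[OF cA] by simp
  qed
  ultimately show ?case by blast
qed

lemma span_image_rescale:
  fixes v :: "'a \<Rightarrow> ('n::finite) cvec"
  assumes "\<And>c. c \<in> C \<Longrightarrow> \<tau> c \<noteq> 0" "\<And>c. c \<in> C \<Longrightarrow> u c = \<tau> c *s v c"
  shows "vec.span (u ` C) = vec.span (v ` C)"
proof
  show "vec.span (u ` C) \<subseteq> vec.span (v ` C)"
  proof (rule vec.span_minimal)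
    show "u ` C \<subseteq> vec.span (v ` C)"
      using assms(2) by (metis (no_types, lifting) image_subsetI imageI vec.span_base vec.span_scale)
  qed (rule vec.subspace_span)
  show "vec.span (v ` C) \<subseteq> vec.span (u ` C)"
  proof (rule vec.span_minimal)
    have "v c = inverse (\<tau> c) *s u c" if "c \<in> C" for c
      using assms(1)[OF that] assms(2)[OF that] by (simp add: vec.scale_scale)
    then show "v ` C \<subseteq> vec.span (u ` C)"
      by (metis (no_types, lifting) image_subsetI imageI vec.span_base vec.span_scale)
  qed (rule vec.subspace_span)
qed

lemma order_forest_torus_equivalent:
  fixes u v :: "'a::linorder \<Rightarrow> ('n::finite) cvec"
  assumes "finite C" "order_forest C v" "\<And>c k. c \<in> C \<Longrightarrow> u c $ k = 0 \<longleftrightarrow> v c $ k = 0"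
  obtains \<sigma> where "\<sigma> \<in> torus" "vec.span (u ` C) = torus_act \<sigma> (vec.span (v ` C))"
proof -
  obtain \<sigma> \<tau> where \<sigma>: "\<sigma> \<in> torus" and \<tau>: "\<And>c. c \<in> C \<Longrightarrow> \<tau> c \<noteq> 0"
    and eq: "\<And>c. c \<in> C \<Longrightarrow> u c = \<tau> c *s dscale \<sigma> (v c)"
    using order_forest_scaling[OF assms] by blast
  have "vec.span (u ` C) = vec.span ((\<lambda>c. dscale \<sigma> (v c)) ` C)"
    by (rule span_image_rescale[OF \<tau> eq])
  also have "\<dots> = torus_act \<sigma> (vec.span (v ` C))" by (simp add: torus_act_span image_image)
  finally show ?thesis by (rule that[OF \<sigma>])
qed

text \<open>\<open>I\<close> ranges over all coordinate sets on which \<open>V\<close> is injective,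
  not only over bases, so no cardinality has to be tracked when rows are removed. For a basis
  \<open>I\<close> the vectors \<open>u\<close> are the fundamental vectors.\<close>

definition unimodular :: "('n::finite) cvec set \<Rightarrow> bool" where
  "unimodular V \<longleftrightarrow> (\<forall>I. injective_coords I V \<longrightarrow> (\<forall>i\<in>I. \<forall>u\<in>V.
     (\<forall>k\<in>I. u $ k = (if k = i then 1 else 0)) \<longrightarrow> (\<forall>k. u $ k \<in> {0, 1, -1})))"

lemma unimodularD:
  assumes "unimodular V" "injective_coords I V" "i \<in> I" "u \<in> V"
    "\<And>k. k \<in> I \<Longrightarrow> u $ k = (if k = i then 1 else 0)"
  shows "u $ k \<in> {0, 1, -1}"
  using assms unfolding unimodular_def by blast

text \<open>Induction on the last vector \<open>v b\<close>. The span \<open>W\<close> of the others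
  vanishes on the private rows \<open>P\<close> of \<open>v b\<close>, among them
  \<open>\<rho> b\<close>, and outside \<open>P\<close> the vector \<open>v b\<close> has at most a
  single 1, in the shared row. Dropping \<open>P\<close> or the shared row turns a coordinate set
  for \<open>V\<close> into one for \<open>W\<close>.\<close>

lemma order_forest_unimodular:
  fixes v :: "'a::linorder \<Rightarrow> ('n::finite) cvec"
  assumes "finite C" "order_forest C v" "\<And>c d. c \<in> C \<Longrightarrow> d \<in> C \<Longrightarrow> v c $ \<rho> d = (if c = d then 1 else 0)"
    "\<And>c k. c \<in> C \<Longrightarrow> v c $ k \<in> {0, 1}"
  shows "unimodular (vec.span (v ` C))"
  using assms
proof (induction C rule: finite_linorder_max_induct)
  case empty
  then show ?case by (auto simp: unimodular_def)
next
  case (insert b A)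
  define W where "W = vec.span (v ` A)"
  define V where "V = vec.span (v ` insert b A)"
  have uniW: "unimodular W"
    unfolding W_def
  proof (rule insert.IH)
    show "order_forest A v" using order_forest_mono[OF insert.prems(1)] by blast
  qed (use insert.prems in auto)
  have WV: "W \<subseteq> V" unfolding W_def V_def by (intro vec.span_mono) auto
  have bV: "v b \<in> V" unfolding V_def by (intro vec.span_base) auto
  have subW: "vec.subspace W" and subV: "vec.subspace V" by (simp_all add: W_def V_def)
  define S where "S = shared_rows (insert b A) v b"
  have S1: "s = s'" if "s \<in> S" "s' \<in> S" for s s'
    using insert.prems(1) that unfolding order_forest_def S_def by blast
  define P where "P = {k. v b $ k \<noteq> 0 \<and> k \<notin> S}"
  have vb01: "v b $ k = 0 \<or> v b $ k = 1" for k using insert.prems(3)[of b k] by auto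
  have vbS: "v b $ k = 1" if "k \<in> S" for k using that vb01[of k] by (auto simp: S_def shared_rows_def)
  have vbP: "v b $ k = 1" if "k \<in> P" for k using that vb01[of k] by (auto simp: P_def)
  have vbo: "v b $ k = 0" if "k \<notin> P" "k \<notin> S" for k using that by (auto simp: P_def)
  have bnA: "b \<notin> A" using insert.hyps(2) by blast
  have \<rho>P: "\<rho> b \<in> P"
    using insert.prems(2) bnA by (auto simp: P_def S_def shared_rows_def)
  have WP: "w $ k = 0" if "w \<in> W" "k \<in> P" for w k
  proof -
    have "v ` A \<subseteq> {x. x $ k = 0}"
      using that(2) insert.hyps(2) by (auto simp: P_def S_def shared_rows_def)
    moreover have "vec.subspace {x :: 'n cvec. x $ k = 0}" by (auto simp: vec.subspace_def)
    ultimately have "W \<subseteq> {x. x $ k = 0}" unfolding W_def by (rule vec.span_minimal)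
    then show ?thesis using that(1) by blast
  qed
  have "\<forall>k. u $ k \<in> {0, 1, -1}" if I: "injective_coords I V" and i: "i \<in> I" and u: "u \<in> V"
    and uI: "\<forall>k\<in>I. u $ k = (if k = i then 1 else 0)" for I i u
  proof -
    have neg_sign: "- x \<in> {0, 1, -1}" if "x \<in> {0, 1, -1}" for x :: complex using that by auto
    have I0: "x = 0" if "x \<in> V" "\<And>k. k \<in> I \<Longrightarrow> x $ k = 0" for x
      using I that unfolding injective_coords_def by blast
    have "u \<in> vec.span (insert (v b) (v ` A))" using u by (simp add: V_def)
    then obtain \<alpha> where \<alpha>: "u - \<alpha> *s v b \<in> W" unfolding W_def vec.span_breakdown_eq by blast
    define u' where "u' = u - \<alpha> *s v b"
    have u'W: "u' \<in> W" using \<alpha> by (simp add: u'_def)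
    have u'k: "u' $ k = u $ k - \<alpha> * v b $ k" for k by (simp add: u'_def)
    show ?thesis
    \<comment> \<open>If \<open>I\<close> meets \<open>P\<close>, an entry there fixes the
      coefficient \<alpha> of \<open>v b\<close>, and \<open>I - P\<close> separates the elements of
      \<open>W\<close>.\<close>
    proof (cases "I \<inter> P = {}")
      case False
      have injW: "injective_coords (I - P) W"
        unfolding injective_coords_def
      proof (intro ballI impI)
        fix w assume w: "w \<in> W" "\<forall>k\<in>I - P. w $ k = 0"
        show "w = 0" by (rule I0) (use w WV WP in auto)
      qed
      show ?thesis
      proof (cases "i \<in> P")
        case True
        have \<alpha>1: "\<alpha> = 1" using u'k[of i] WP[OF u'W True] vbP[OF True] uI i by simp
        show ?thesis
        proof (cases "S \<inter> (I - P) = {}")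
          case S: True
          have "u' $ k = 0" if "k \<in> I - P" for k
            using u'k[of k] uI that True vbo[of k] S by auto
          then have "u' = 0" using injW u'W unfolding injective_coords_def by blast
          then have "u $ k = v b $ k" for k using u'k[of k] \<alpha>1 by simp
          then show ?thesis using vb01 by auto
        next
          case S: False
          then obtain s where s: "s \<in> S" "s \<in> I - P" by blast
          \<comment> \<open>On \<open>I - P\<close> the vector \<open>u\<close> is 0, so
            \<open>- u'\<close> agrees with \<open>v b\<close>, which is the indicator of the shared
            row there.\<close>
          have "(- u') $ k = (if k = s then 1 else 0)" if k: "k \<in> I - P" for k
          proof -
            have "u $ k = 0" using uI k True by auto
            then have "(- u') $ k = v b $ k" using u'k[of k] \<alpha>1 by simp
            then show ?thesis using vbS[OF s(1)] vbo[of k] S1[OF s(1), of k] k by (cases "k \<in> S") auto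
          qed
          then have *: "(- u') $ k \<in> {0, 1, -1}" for k
            using s by (intro unimodularD[OF uniW injW s(2) vec.subspace_neg[OF subW u'W]])
          have "u $ k \<in> {0, 1, -1}" for k
          proof -
            consider "k \<in> P" | "k \<in> S" | "k \<notin> P" "k \<notin> S" by blast
            then show ?thesis
            proof cases
              case 1 then show ?thesis using u'k[of k] WP[OF u'W 1] vbP[OF 1] \<alpha>1 by simp
            next
              case 2
              then have "k \<in> I" using S1[OF s(1) 2] s by simp
              then show ?thesis using uI by simp
            next
              case 3
              then have "(- u') $ k = - (u $ k)" using u'k[of k] vbo[OF 3] by simp
              then show ?thesis using neg_sign[OF *[of k]] by simp
            qed
          qed
          then show ?thesis by blast
        qed
      next
        case iP: False
        obtain a where a: "a \<in> I" "a \<in> P" using False by blast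
        have "u $ a = 0" using uI a iP by auto
        then have "\<alpha> = 0" using u'k[of a] WP[OF u'W a(2)] vbP[OF a(2)] by simp
        then have "u \<in> W" using u'W by (simp add: u'_def)
        then show ?thesis using unimodularD[OF uniW injW, of i u] uI i iP by auto
      qed
    next
      case True
      have "v b \<noteq> 0" using vbP[OF \<rho>P] by auto
      then obtain s where s: "s \<in> I" "v b $ s \<noteq> 0" using I0[OF bV] by blast
      then have sS: "s \<in> S" using vbo[of s] True by blast
      have vbI: "v b $ k = (if k = s then 1 else 0)" if "k \<in> I" for k
        using that vbS[OF sS] vbo[of k] S1[OF sS, of k] True by (cases "k \<in> S") auto
      have injW: "injective_coords (I - {s}) W"
        unfolding injective_coords_def
      proof (intro ballI impI)
        fix w assume w: "w \<in> W" "\<forall>k\<in>I - {s}. w $ k = 0"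
        have "w - w $ s *s v b = 0"
        proof (rule I0)
          show "w - w $ s *s v b \<in> V"
            using w WV bV subV by (intro vec.subspace_diff vec.subspace_scale) auto
        qed (use w vbI in auto)
        then have "(w - w $ s *s v b) $ \<rho> b = 0" by simp
        then have "w $ s = 0" using WP[OF w(1) \<rho>P] vbP[OF \<rho>P] by simp
        then show "w = 0" using w WV by (intro I0) auto
      qed
      show ?thesis
      proof (cases "i = s")
        case True
        have "u' $ k = 0" if "k \<in> I - {s}" for k using that u'k[of k] uI vbI True by auto
        then have "u' = 0" using injW u'W unfolding injective_coords_def by blast
        then have u: "u $ k = \<alpha> * v b $ k" for k using u'k[of k] by simp
        then have "\<alpha> = 1" using uI[rule_format, OF i] vbI[OF s(1)] True by simp
        then show ?thesis using u vb01 by auto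
      next
        case False
        have "u' $ k = (if k = i then 1 else 0)" if "k \<in> I - {s}" for k
          using that u'k[of k] uI vbI by auto
        then have *: "u' $ k \<in> {0, 1, -1}" for k
          using i False by (intro unimodularD[OF uniW injW _ u'W]) auto
        have "u' $ s = - \<alpha>" using u'k[of s] uI s vbI False by auto
        then have \<alpha>: "\<alpha> \<in> {0, 1, -1}" using neg_sign[OF *[of s]] by simp
        have "u $ k \<in> {0, 1, -1}" for k
        proof -
          consider "k \<in> P" | "k \<in> S" | "k \<notin> P" "k \<notin> S" by blast
          then show ?thesis
          proof cases
            case 1 then show ?thesis using u'k[of k] WP[OF u'W 1] vbP[OF 1] \<alpha> by simp
          next
            case 2
            then show ?thesis using S1[OF sS 2] s uI by auto
          next
            case 3 then show ?thesis using u'k[of k] vbo[OF 3] *[of k] by simp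
          qed
        qed
        then show ?thesis by blast
      qed
    qed
  qed
  then show ?case unfolding unimodular_def V_def by blast
qed

subsection \<open>Frames of points of the quasisymmetric Grassmannian\<close>

definition forest_frame :: "'n set \<Rightarrow> ('n \<Rightarrow> 'n) \<Rightarrow> ('n::{finite,linorder} \<Rightarrow> 'n cvec) \<Rightarrow> bool" where
  "forest_frame C \<rho> v \<longleftrightarrow> order_forest C v \<and> (\<forall>c\<in>C. \<forall>d\<in>C. v c $ \<rho> d = (if c = d then 1 else 0))"

lemma forest_frame_basis:
  assumes "forest_frame C \<rho> v"
  shows "inj_on \<rho> C" "\<rho> ` C \<in> matroid_bases (vec.span (v ` C))"
    "c \<in> C \<Longrightarrow> fund_vec (vec.span (v ` C)) (\<rho> ` C) (\<rho> c) = v c"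
proof -
  have \<delta>: "v c $ \<rho> d = (if c = d then 1 else 0)" if "c \<in> C" "d \<in> C" for c d
    using assms that by (simp add: forest_frame_def)
  show inj: "inj_on \<rho> C"
  proof (rule inj_onI)
    fix c d assume "c \<in> C" "d \<in> C" "\<rho> c = \<rho> d"
    then show "c = d" using \<delta>[of c d] \<delta>[of c c] by (cases "c = d") auto
  qed
  have injv: "inj_on v C"
  proof (rule inj_onI)
    fix c d assume "c \<in> C" "d \<in> C" "v c = v d"
    then show "c = d" using \<delta>[of c d] \<delta>[of d d] by (cases "c = d") auto
  qed
  have ind: "vec.independent (v ` C)"
    unfolding vec.dependent_def
  proof
    assume "\<exists>a\<in>v ` C. a \<in> vec.span (v ` C - {a})"
    then obtain c where c: "c \<in> C" "v c \<in> vec.span (v ` C - {v c})" by blast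
    have "v ` C - {v c} \<subseteq> {x. x $ \<rho> c = 0}" using \<delta> c(1) by auto
    moreover have "vec.subspace {x :: 'a cvec. x $ \<rho> c = 0}" by (auto simp: vec.subspace_def)
    ultimately have "vec.span (v ` C - {v c}) \<subseteq> {x. x $ \<rho> c = 0}" by (rule vec.span_minimal)
    then show False using c \<delta>[OF c(1) c(1)] by auto
  qed
  have "vec.dim (vec.span (v ` C)) = card C"
    unfolding vec.dim_span using ind injv by (simp add: vec.dim_eq_card_independent card_image)
  moreover have "u = 0" if u: "u \<in> vec.span (v ` C)" "\<forall>i\<in>\<rho> ` C. u $ i = 0" for u
  proof -
    \<comment> \<open>\<open>?E\<close> consists of the vectors recovered from their pivot entries;
      it is a subspace containing the frame, hence the span.\<close>
    let ?E = "{u. u = (\<Sum>c\<in>C. u $ \<rho> c *s v c)}"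
    have "v c \<in> ?E" if c: "c \<in> C" for c
    proof -
      have "(\<Sum>d\<in>C. v c $ \<rho> d *s v d) = (\<Sum>d\<in>C. if c = d then v d else 0)"
        by (intro sum.cong refl) (simp add: \<delta>[OF c])
      then show ?thesis using c by simp
    qed
    then have "v ` C \<subseteq> ?E" by blast
    moreover have "vec.subspace ?E"
    proof (rule vec.subspaceI)
      show "0 \<in> ?E" by simp
    next
      fix x y assume xy: "x \<in> ?E" "y \<in> ?E"
      have x: "(\<Sum>c\<in>C. x $ \<rho> c *s v c) = x" using CollectD[OF xy(1)] by (rule sym)
      have y: "(\<Sum>c\<in>C. y $ \<rho> c *s v c) = y" using CollectD[OF xy(2)] by (rule sym)
      have "(\<Sum>c\<in>C. (x + y) $ \<rho> c *s v c) = (\<Sum>c\<in>C. x $ \<rho> c *s v c) + (\<Sum>c\<in>C. y $ \<rho> c *s v c)"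
        by (simp add: vec.scale_left_distrib sum.distrib)
      then have "x + y = (\<Sum>c\<in>C. (x + y) $ \<rho> c *s v c)" unfolding x y by (rule sym)
      then show "x + y \<in> ?E" by (rule CollectI)
    next
      fix a x assume x: "x \<in> ?E"
      have x: "(\<Sum>c\<in>C. x $ \<rho> c *s v c) = x" using CollectD[OF x] by (rule sym)
      have "(\<Sum>c\<in>C. (a *s x) $ \<rho> c *s v c) = a *s (\<Sum>c\<in>C. x $ \<rho> c *s v c)"
        by (simp add: vec.scale_sum_right vec.scale_scale)
      then have "a *s x = (\<Sum>c\<in>C. (a *s x) $ \<rho> c *s v c)" unfolding x by (rule sym)
      then show "a *s x \<in> ?E" by (rule CollectI)
    qed
    ultimately have "vec.span (v ` C) \<subseteq> ?E" by (rule vec.span_minimal)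
    then have "u = (\<Sum>c\<in>C. u $ \<rho> c *s v c)" using u(1) by blast
    also have "\<dots> = 0" using u(2) by simp
    finally show ?thesis .
  qed
  ultimately show B: "\<rho> ` C \<in> matroid_bases (vec.span (v ` C))"
    using inj by (simp add: matroid_bases_def injective_coords_def card_image)
  show "fund_vec (vec.span (v ` C)) (\<rho> ` C) (\<rho> c) = v c" if c: "c \<in> C"
    using c inj \<delta>[OF c]
    by (intro fund_vec(3)[OF vec.subspace_span B] vec.span_base) (auto simp: inj_on_eq_iff)
qed

text \<open>The first \<open>r\<close> columns of a cell matrix carry 1 at their pivots. Once the
  other pivot rows are cleared, a row shared by two columns is an inversion row for both, and
  \<open>Inv_NC_shared_unique\<close> gives the forest.\<close>

lemma QGr_forest_frame:
  assumes r: "r \<le> CARD('n)" and x: "x \<in> (QGr r :: ('n::{finite,linorder}) cvec set set)"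
  obtains C \<rho> v where "forest_frame C \<rho> v" "x = vec.span (v ` C)" "x \<in> Gr r"
proof -
  obtain w V and M :: "'n cmat" where w: "w \<in> NC" and V: "V \<in> Fl" and M: "M \<in> NC_cell_matrices w"
    and VM: "V = flag_of M" and xV: "x = V r"
    using x by (auto simp: QGr_def QFl_def NC_cell_def)
  define C where "C = {c :: 'n. card {..c} \<le> r}"
  have bij: "bij w" by (rule NC_bij[OF w])
  have winv: "w (inv_into UNIV w i) = i" for i by (rule surj_f_inv_f[OF bij_is_surj[OF bij]])
  have invw: "inv_into UNIV w (w c) = c" for c by (rule inv_f_f[OF bij_is_inj[OF bij]])
  have weq: "w c = w d \<longleftrightarrow> c = d" for c d using bij by (simp add: bij_is_inj inj_eq)
  have M1: "M $ w c $ c = 1" for c using M by (simp add: NC_cell_matrices_def)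
  have M0: "a = w b \<or> (a, w b) \<in> Inv_NC w" if "M $ a $ b \<noteq> 0" for a b
  proof (rule ccontr)
    assume "\<not> (a = w b \<or> (a, w b) \<in> Inv_NC w)"
    moreover from this have "(a, b) \<notin> {(i, inv_into UNIV w j) | i j. (i, j) \<in> Inv_NC w}"
      using winv by auto
    ultimately have "M $ a $ b = 0" using M by (auto simp: NC_cell_matrices_def)
    then show False using that by simp
  qed
  have xspan: "x = vec.span ((\<lambda>c. column c M) ` C)"
  proof -
    have "{column j M |j. card {..j} \<le> r} = (\<lambda>c. column c M) ` C" by (auto simp: C_def)
    then show ?thesis by (simp add: xV VM flag_of_def)
  qed
  \<comment> \<open>An entry in the pivot row of another column \<open>d\<close> can be cleared, since \<open>d\<close> is then a unit
    vector.\<close>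
  define v where "v c = (\<chi> i. if i \<noteq> w c \<and> inv_into UNIV w i \<in> C then 0 else M $ i $ c)" for c
  have unit: "column d M = axis (w d) 1" "v d = axis (w d) 1"
    if "M $ (w d) $ c \<noteq> 0" "d \<noteq> c" for c d
  proof -
    \<comment> \<open>\<open>w d\<close> is the smaller entry of an inversion, so it is the larger
      entry of none, and column \<open>d\<close> has nothing but its pivot.\<close>
    have "(w d, w c) \<in> Inv_NC w" using M0[OF that(1)] weq that(2) by blast
    then have "(k, w d) \<notin> Inv_NC w" for k by (rule Inv_NC_no_chain[OF w])
    then have "M $ k $ d = (if k = w d then 1 else 0)" for k
      using M0[of k d] M1[of d] by (cases "k = w d") auto
    then show "column d M = axis (w d) 1" "v d = axis (w d) 1"
      by (auto simp: Finite_Cartesian_Product.vec_eq_iff column_def axis_def v_def)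
  qed
  have diff: "column c M - v c = (\<Sum>d\<in>C - {c}. M $ w d $ c *s axis (w d) 1)" for c
  proof -
    have "(\<Sum>d\<in>C - {c}. M $ w d $ c *s axis (w d) 1) $ i = (column c M - v c) $ i" for i
    proof -
      define d where "d = inv_into UNIV w i"
      have i: "i = w d" using winv by (simp add: d_def)
      have "(\<Sum>d\<in>C - {c}. M $ w d $ c *s axis (w d) 1) $ i = (\<Sum>e\<in>C - {c}. if e = d then M $ i $ c else 0)"
        unfolding sum_component by (intro sum.cong refl) (auto simp: axis_def i weq)
      also have "\<dots> = (if d \<in> C - {c} then M $ i $ c else 0)" by simp
      also have "\<dots> = (column c M - v c) $ i" by (auto simp: v_def column_def i invw weq)
      finally show ?thesis .
    qed
    then show ?thesis by (simp add: Finite_Cartesian_Product.vec_eq_iff)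
  qed
  have summand: "M $ w d $ c *s axis (w d) 1 \<in> vec.span (f ` C)"
    if "d \<in> C - {c}" "f = v \<or> f = (\<lambda>c. column c M)" for c d f
  proof (cases "M $ w d $ c = 0")
    case False
    then have "axis (w d) 1 = f d" using unit[OF False] that by auto
    moreover have "f d \<in> vec.span (f ` C)" using that(1) by (intro vec.span_base) auto
    ultimately show ?thesis by (simp add: vec.span_scale)
  qed (simp add: vec.span_zero)
  have dspan: "column c M - v c \<in> vec.span (f ` C)" if "f = v \<or> f = (\<lambda>c. column c M)" for c f
    unfolding diff by (rule vec.span_sum) (rule summand[OF _ that])
  have "x = vec.span (v ` C)"
  proof
    have "column c M \<in> vec.span (v ` C)" if "c \<in> C" for c
      using vec.span_add[OF dspan[of v c] vec.span_base[of "v c" "v ` C"]] that by simp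
    then show "x \<subseteq> vec.span (v ` C)" unfolding xspan by (intro vec.span_minimal) auto
    have "v c \<in> x" if "c \<in> C" for c
      using vec.span_diff[OF vec.span_base[of "column c M" "(\<lambda>c. column c M) ` C"] dspan[of "\<lambda>c. column c M" c]] that
      by (simp add: xspan)
    then show "vec.span (v ` C) \<subseteq> x" unfolding xspan by (intro vec.span_minimal) auto
  qed
  moreover have "forest_frame C w v"
    unfolding forest_frame_def order_forest_def
  proof (intro conjI ballI)
    have shared: "\<exists>d. d < c \<and> (s, w c) \<in> Inv_NC w \<and> (s, w d) \<in> Inv_NC w"
      if cs: "c \<in> C" "s \<in> shared_rows C v c" for c s
    proof -
      obtain d where d: "d \<in> C" "d < c" and nz: "v c $ s \<noteq> 0" "v d $ s \<noteq> 0"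
        using cs(2) by (auto simp: shared_rows_def)
      have "s \<noteq> w c"
      proof
        assume "s = w c"
        then have "v d $ s = 0" using d cs(1) by (auto simp: v_def invw weq)
        then show False using nz by simp
      qed
      moreover from this have "inv_into UNIV w s \<notin> C" using nz by (auto simp: v_def split: if_splits)
      then have "s \<noteq> w d" using d invw by auto
      moreover have "M $ s $ c \<noteq> 0" "M $ s $ d \<noteq> 0" using nz by (auto simp: v_def split: if_splits)
      ultimately show ?thesis using M0 d by blast
    qed
    fix c s s' assume c: "c \<in> C" and s: "s \<in> shared_rows C v c" "s' \<in> shared_rows C v c"
    obtain d where d: "d < c" "(s, w c) \<in> Inv_NC w" "(s, w d) \<in> Inv_NC w" using shared[OF c s(1)] by blast
    obtain d' where d': "d' < c" "(s', w c) \<in> Inv_NC w" "(s', w d') \<in> Inv_NC w" using shared[OF c s(2)] by blast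
    show "s = s'"
      by (rule Inv_NC_shared_unique[OF w d(2,3) _ d'(2,3)]) (simp_all add: invw d d')
  next
    fix c d assume "c \<in> C" "d \<in> C"
    then show "v c $ w d = (if c = d then 1 else 0)" by (auto simp: v_def invw weq M1)
  qed
  moreover have "x \<in> Gr r" using V r by (simp add: xV Fl_def Gr_def)
  ultimately show ?thesis by (intro that)
qed

subsection \<open>Pluecker coordinates\<close>

lemma plucker_cong:
  assumes "\<And>b. b < r \<Longrightarrow> us b = vs b" shows "plucker r us = plucker r vs"
proof -
  have "Matrix.mat r r (\<lambda>(a, b). us b $ f a) = Matrix.mat r r (\<lambda>(a, b). vs b $ f a)" for f
    using assms by (intro cong_mat) auto
  then show ?thesis by (auto simp: plucker_def fun_eq_iff)
qed

lemma plucker_eq_sum: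
  assumes "card I = r"
  shows "plucker r vs I = (\<Sum>p | p permutes {0..<r}. signof p *
    (\<Prod>a = 0..<r. vs (p a) $ (sorted_list_of_set I ! a)))"
proof -
  have "plucker r vs I = Determinant.det (Matrix.mat r r (\<lambda>(a, b). vs b $ (sorted_list_of_set I ! a)))"
    using assms by (simp add: plucker_def)
  also have "\<dots> = (\<Sum>p | p permutes {0..<r}. signof p *
    (\<Prod>a = 0..<r. Matrix.mat r r (\<lambda>(a, b). vs b $ (sorted_list_of_set I ! a)) $$ (a, p a)))"
    by (rule det_def') simp
  also have "\<dots> = (\<Sum>p | p permutes {0..<r}. signof p *
    (\<Prod>a = 0..<r. vs (p a) $ (sorted_list_of_set I ! a)))"
  proof (intro sum.cong arg_cong2[of _ _ _ _ "(*)"] prod.cong refl)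
    fix p a assume "p \<in> {p. p permutes {0..<r}}" "a \<in> {0..<r}"
    then have "a < r" "p a < r" using permutes_in_image[of p "{0..<r}" a] by auto
    then show "Matrix.mat r r (\<lambda>(a, b). vs b $ (sorted_list_of_set I ! a)) $$ (a, p a)
        = vs (p a) $ (sorted_list_of_set I ! a)" by simp
  qed
  finally show ?thesis .
qed

lemma plucker_dscale:
  "plucker r (\<lambda>b. dscale t (vs b)) I = (\<Prod>i\<in>I. t $ i) * plucker r vs I"
proof (cases "card I = r")
  case True
  let ?L = "sorted_list_of_set I"
  have "bij_betw ((!) ?L) {0..<r} I"
    using True by (intro bij_betw_nth) (auto simp: lessThan_atLeast0)
  then have "(\<Prod>a = 0..<r. t $ (?L ! a)) = (\<Prod>i\<in>I. t $ i)" by (rule prod.reindex_bij_betw)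
  then show ?thesis
    by (simp add: plucker_eq_sum[OF True] prod.distrib sum_distrib_left mult_ac)
qed (simp add: plucker_def)

lemma Gr_spanning_tuple:
  assumes "V \<in> Gr r" obtains vs where "vec.span (vs ` {..<r}) = V"
proof -
  obtain B where B: "B \<subseteq> V" "vec.independent B" "V \<subseteq> vec.span B" "card B = vec.dim V"
    using vec.basis_exists by blast
  then have "finite B" "card B = r" using assms by (auto simp: Gr_def vec.finiteI_independent)
  then obtain f where "bij_betw f {..<r} B" using ex_bij_betw_nat_finite[of B] by (auto simp: lessThan_atLeast0)
  then have "f ` {..<r} = B" by (simp add: bij_betw_def)
  moreover have "vec.span B = V"
    using B assms vec.span_minimal[of B V] by (auto simp: Gr_def)
  ultimately show ?thesis using that by blast
qed

lemma spanning_tuple_independent: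
  fixes vs :: "nat \<Rightarrow> ('n::finite) cvec"
  assumes "vec.span (vs ` {..<r}) = V" "vec.dim V = r" "(\<Sum>b<r. c b *s vs b) = 0" "b < r"
  shows "c b = 0"
proof -
  let ?B = "vs ` {..<r}"
  have "card ?B \<le> r" using card_image_le[of "{..<r}" vs] by simp
  moreover have "r \<le> card ?B" using vec.dim_le_card[of V ?B] assms by simp
  ultimately have card: "card ?B = r" by simp
  then have inj: "inj_on vs {..<r}" by (intro eq_card_imp_inj_on) auto
  have ind: "vec.independent ?B"
    using assms card by (intro vec.card_le_dim_spanning[of ?B V]) (auto simp: vec.span_base)
  have "(\<Sum>x\<in>?B. c (the_inv_into {..<r} vs x) *s x) = (\<Sum>b<r. c b *s vs b)"
    by (simp add: sum.reindex[OF inj] the_inv_into_f_f[OF inj])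
  then have "c (the_inv_into {..<r} vs (vs b)) = 0"
    using assms by (intro vec.independentD[OF ind, of ?B "\<lambda>x. c (the_inv_into {..<r} vs x)"]) auto
  then show ?thesis using the_inv_into_f_f[OF inj] assms by simp
qed

text \<open>A kernel vector of the minor is the coefficient vector of an element of \<open>V\<close>
  vanishing on \<open>I\<close>; it yields a nonzero element because the tuple is
  independent.\<close>

lemma plucker_eq_0_iff:
  fixes vs :: "nat \<Rightarrow> ('n::{finite,linorder}) cvec"
  assumes sp: "vec.span (vs ` {..<r}) = V" and V: "V \<in> Gr r"
  shows "plucker r vs I \<noteq> 0 \<longleftrightarrow> I \<in> matroid_bases V"
proof (cases "card I = r")
  case False then show ?thesis using V by (simp add: plucker_def matroid_bases_def Gr_def)
next
  case True
  let ?L = "sorted_list_of_set I"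
  define A where "A = Matrix.mat r r (\<lambda>(a, b). vs b $ (?L ! a))"
  have A: "A \<in> carrier_mat r r" by (simp add: A_def)
  have dim: "vec.dim V = r" and sub: "vec.subspace V" using V by (auto simp: Gr_def)
  have Lset: "{?L ! a | a. a < r} = I"
  proof -
    have "{?L ! a | a. a < length ?L} = set ?L" by (auto simp: set_conv_nth)
    then show ?thesis using True by simp
  qed
  have mult: "Matrix.vec_index (A *\<^sub>v c) a = (\<Sum>b<r. Matrix.vec_index c b *s vs b) $ (?L ! a)"
    if "c \<in> carrier_vec r" "a < r" for c a
    using that by (simp add: A_def scalar_prod_def sum_component lessThan_atLeast0 mult.commute)
  have "plucker r vs I = 0 \<longleftrightarrow> (\<exists>c. c \<in> carrier_vec r \<and> c \<noteq> 0\<^sub>v r \<and> A *\<^sub>v c = 0\<^sub>v r)"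
    using True det_0_iff_vec_prod_zero[OF A] by (simp add: plucker_def A_def)
  also have "\<dots> \<longleftrightarrow> (\<exists>v\<in>V. (\<forall>i\<in>I. v $ i = 0) \<and> v \<noteq> 0)"
  proof
    assume "\<exists>c. c \<in> carrier_vec r \<and> c \<noteq> 0\<^sub>v r \<and> A *\<^sub>v c = 0\<^sub>v r"
    then obtain c where c: "c \<in> carrier_vec r" "c \<noteq> 0\<^sub>v r" "A *\<^sub>v c = 0\<^sub>v r" by blast
    let ?v = "\<Sum>b<r. Matrix.vec_index c b *s vs b"
    have "?v \<in> V" unfolding sp[symmetric] by (intro vec.span_sum vec.span_scale vec.span_base) auto
    moreover have "?v $ i = 0" if i: "i \<in> I" for i
    proof -
      obtain a where a: "a < r" "i = ?L ! a" using i Lset by blast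
      have "?v $ i = Matrix.vec_index (A *\<^sub>v c) a" unfolding a(2) by (rule mult[OF c(1) a(1), symmetric])
      also have "\<dots> = 0" using c(3) a(1) by simp
      finally show ?thesis .
    qed
    moreover have "?v \<noteq> 0"
    proof
      assume "?v = 0"
      then have "Matrix.vec_index c b = 0" if "b < r" for b
        using spanning_tuple_independent[OF sp dim, of "Matrix.vec_index c"] that by blast
      then show False using c(1,2) by (auto simp: Matrix.vec_eq_iff)
    qed
    ultimately show "\<exists>v\<in>V. (\<forall>i\<in>I. v $ i = 0) \<and> v \<noteq> 0" by blast
  next
    assume "\<exists>v\<in>V. (\<forall>i\<in>I. v $ i = 0) \<and> v \<noteq> 0"
    then obtain v where v: "v \<in> V" "\<And>i. i \<in> I \<Longrightarrow> v $ i = 0" "v \<noteq> 0" by blast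
    have "\<exists>c. u = (\<Sum>b<r. c b *s vs b)" if "u \<in> vec.span (vs ` {..<r})" for u
      using that
    proof (induction rule: vec.span_induct_alt)
      case base then show ?case by (intro exI[of _ "\<lambda>_. 0"]) simp
    next
      case (step a x y)
      then obtain b c where b: "b < r" "x = vs b" "y = (\<Sum>b<r. c b *s vs b)" by blast
      have "(\<Sum>d<r. (c d + (if d = b then a else 0)) *s vs d) = y + (\<Sum>d<r. if d = b then a *s vs d else 0)"
        unfolding b(3) sum.distrib[symmetric] by (intro sum.cong refl) (simp add: vec.scale_left_distrib)
      also have "\<dots> = a *s x + y" using b by simp
      finally show ?case by metis
    qed
    then obtain c where c: "v = (\<Sum>b<r. c b *s vs b)" using v(1) sp by blast
    let ?c = "Matrix.vec r c"
    have c': "v = (\<Sum>b<r. Matrix.vec_index ?c b *s vs b)" unfolding c by (intro sum.cong) auto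
    have "?c \<noteq> 0\<^sub>v r"
    proof
      assume "?c = 0\<^sub>v r"
      then have "v = 0" unfolding c' by simp
      then show False using v(3) by simp
    qed
    moreover have "A *\<^sub>v ?c = 0\<^sub>v r"
    proof (rule Matrix.eq_vecI)
      fix a assume "a < Matrix.dim_vec (0\<^sub>v r :: complex Matrix.vec)"
      then have a: "a < r" by simp
      have "?L ! a \<in> I" using Lset a by blast
      then show "Matrix.vec_index (A *\<^sub>v ?c) a = Matrix.vec_index (0\<^sub>v r) a"
        using mult[of ?c a] c' v(2) a by simp
    qed (simp add: A_def)
    ultimately show "\<exists>c. c \<in> carrier_vec r \<and> c \<noteq> 0\<^sub>v r \<and> A *\<^sub>v c = 0\<^sub>v r"
      by (intro exI[of _ ?c]) simp
  qed
  also have "\<dots> \<longleftrightarrow> \<not> injective_coords I V" by (auto simp: injective_coords_def)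
  finally show ?thesis using True dim by (simp add: matroid_bases_def)
qed

subsection \<open>Curves in the Grassmannian\<close>

text \<open>Homogeneous polynomials are encoded as functions, so polynomiality in a curve parameter
  is made a property of functions too; rule induction over \<open>homogeneous_poly\<close> then
  transfers it.\<close>

definition polyfun :: "(complex \<Rightarrow> complex) \<Rightarrow> bool" where
  "polyfun f \<longleftrightarrow> (\<exists>p. \<forall>s. f s = poly p s)"

lemma polyfun_const [intro, simp]: "polyfun (\<lambda>s. c)"
  unfolding polyfun_def by (intro exI[of _ "[:c:]"]) simp

lemma polyfun_id [intro, simp]: "polyfun (\<lambda>s. s)"
  unfolding polyfun_def by (intro exI[of _ "[:0, 1:]"]) simp

lemma polyfun_add [intro]: assumes "polyfun f" "polyfun g" shows "polyfun (\<lambda>s. f s + g s)"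
proof -
  obtain p q where "\<forall>s. f s = poly p s" "\<forall>s. g s = poly q s" using assms by (auto simp: polyfun_def)
  then show ?thesis unfolding polyfun_def by (intro exI[of _ "p + q"]) simp
qed

lemma polyfun_mult [intro]: assumes "polyfun f" "polyfun g" shows "polyfun (\<lambda>s. f s * g s)"
proof -
  obtain p q where "\<forall>s. f s = poly p s" "\<forall>s. g s = poly q s" using assms by (auto simp: polyfun_def)
  then show ?thesis unfolding polyfun_def by (intro exI[of _ "p * q"]) simp
qed

lemma polyfun_sum [intro]: "(\<And>i. i \<in> A \<Longrightarrow> polyfun (f i)) \<Longrightarrow> polyfun (\<lambda>s. \<Sum>i\<in>A. f i s)"
  by (induction A rule: infinite_finite_induct) auto

lemma polyfun_prod [intro]: "(\<And>i. i \<in> A \<Longrightarrow> polyfun (f i)) \<Longrightarrow> polyfun (\<lambda>s. \<Prod>i\<in>A. f i s)"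
  by (induction A rule: infinite_finite_induct) auto

lemma polyfun_power: "polyfun (\<lambda>s. s ^ n)"
  by (induction n) auto

lemma polyfun_finite_zeros:
  assumes "polyfun f" "f s0 \<noteq> 0" shows "finite {s. f s = 0}"
proof -
  obtain p where p: "\<And>s. f s = poly p s" using assms by (auto simp: polyfun_def)
  then have "p \<noteq> 0" using assms(2) by auto
  then show ?thesis using poly_roots_finite[of p] by (simp add: p)
qed

lemma polyfun_homogeneous_poly:
  assumes "homogeneous_poly d F" "\<And>i. polyfun (\<lambda>s. p s i)"
  shows "polyfun (\<lambda>s. F (p s))"
  using assms by (induction rule: homogeneous_poly.induct) auto

lemma polyfun_plucker:
  assumes "\<And>b i. polyfun (\<lambda>s. vs s b $ i)" shows "polyfun (\<lambda>s. plucker r (vs s) I)"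
proof (cases "card I = r")
  case True
  have "polyfun (\<lambda>s. \<Sum>p | p permutes {0..<r}. signof p *
    (\<Prod>a = 0..<r. vs s (p a) $ (sorted_list_of_set I ! a)))"
    by (intro polyfun_sum polyfun_mult polyfun_prod polyfun_const assms)
  then show ?thesis by (simp only: plucker_eq_sum[OF True])
qed (simp add: plucker_def)

lemma homogeneous_poly_rescale:
  assumes "homogeneous_poly d F" shows "homogeneous_poly d (\<lambda>p. F (\<lambda>i. a i * p i))"
  using assms
proof (induction rule: homogeneous_poly.induct)
  case (var i)
  have "homogeneous_poly (0 + 1) (\<lambda>p. (\<lambda>p. a i) p * (\<lambda>p. p i) p)"
    by (intro homogeneous_poly.intros)
  then show ?case by simp
qed (auto intro: homogeneous_poly.intros)

section \<open>Zariski open sets along polynomial families of linear maps\<close>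

lemma openin_zariski_iff:
  "openin (zariski_Gr r) S \<longleftrightarrow>
    generate_topology_on {Gr r - Gr_zeros r F | d F. homogeneous_poly d F} S"
  unfolding zariski_Gr_def by (rule openin_topology_generated_by_iff)

lemma openin_zariski_nonzeros:
  "homogeneous_poly d F \<Longrightarrow> openin (zariski_Gr r) (Gr r - Gr_zeros r F)"
  unfolding openin_zariski_iff by (intro generate_topology_on.Basis) blast

lemma topspace_zariski [simp]: "topspace (zariski_Gr r) = (Gr r :: ('n::{finite,linorder}) cvec set set)"
proof -
  have "Gr_zeros r (\<lambda>p. 1) = ({} :: 'n cvec set set)"
    unfolding Gr_zeros_def using Gr_spanning_tuple by (metis (mono_tags, lifting) empty_Collect_eq zero_neq_one)
  then have "(Gr r :: 'n cvec set set) = Gr r - Gr_zeros r (\<lambda>p. 1)" by simp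
  then have "openin (zariski_Gr r) (Gr r :: 'n cvec set set)"
    using openin_zariski_nonzeros[OF homogeneous_poly.const[of 1], of r] by metis
  then have "(Gr r :: 'n cvec set set) \<subseteq> topspace (zariski_Gr r)" by (rule openin_subset)
  moreover have "topspace (zariski_Gr r) \<subseteq> (Gr r :: 'n cvec set set)"
    unfolding zariski_Gr_def topology_generated_by_topspace by blast
  ultimately show ?thesis by blast
qed

text \<open>Only generators need work: a spanning tuple witnessing membership at \<open>s0\<close>
  is pulled back to \<open>W\<close>, and its images under \<open>L s\<close> turn the defining
  equation into a polynomial in \<open>s\<close> that is nonzero at \<open>s0\<close>. Parameters
  where \<open>L s\<close> is not injective are left out, since there the image drops in
  dimension.\<close>

lemma openin_zariski_curve:
  fixes L :: "complex \<Rightarrow> 'n cvec \<Rightarrow> ('n::{finite,linorder}) cvec"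
  assumes "openin (zariski_Gr r) S" and W: "W \<in> Gr r"
    and lin: "\<And>s. Vector_Spaces.linear (*s) (*s) (L s)" and pf: "\<And>u i. polyfun (\<lambda>s. L s u $ i)"
    and "inj_on (L s0) W" "L s0 ` W \<in> S"
  shows "finite {s. inj_on (L s) W \<and> L s ` W \<notin> S}"
  using assms(1)[unfolded openin_zariski_iff] assms(5,6)
proof (induction arbitrary: s0 rule: generate_topology_on.induct)
  case Empty
  then show ?case by simp
next
  case (Int a b)
  have "finite {s. inj_on (L s) W \<and> L s ` W \<notin> a}" "finite {s. inj_on (L s) W \<and> L s ` W \<notin> b}"
    using Int.IH[of s0] Int.prems by auto
  then show ?case by (rule rev_finite_subset[OF finite_UnI]) auto
next
  case (UN K)
  then obtain k where k: "k \<in> K" "L s0 ` W \<in> k" by blast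
  then have "finite {s. inj_on (L s) W \<and> L s ` W \<notin> k}" using UN by blast
  then show ?case by (rule rev_finite_subset) (use k in auto)
next
  case (Basis S)
  then obtain d F where F: "homogeneous_poly d F" and S: "S = Gr r - Gr_zeros r F" by blast
  have subW: "vec.subspace W" and dimW: "vec.dim W = r" using W by (auto simp: Gr_def)
  obtain us where us: "vec.span (us ` {..<r}) = L s0 ` W" "F (plucker r us) \<noteq> 0"
    using Basis.prems(2) by (auto simp: S Gr_zeros_def)
  have "\<exists>v. v \<in> W \<and> (b < r \<longrightarrow> L s0 v = us b)" for b
  proof (cases "b < r")
    case True
    then have "us b \<in> L s0 ` W" unfolding us(1)[symmetric] by (intro vec.span_base) auto
    then show ?thesis by auto
  next
    case False
    then show ?thesis using vec.subspace_0[OF subW] by blast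
  qed
  then obtain ws where ws: "\<And>b. ws b \<in> W" "\<And>b. b < r \<Longrightarrow> L s0 (ws b) = us b" by metis
  have "vec.span (ws ` {..<r}) \<subseteq> W" using ws(1) subW by (intro vec.span_minimal) auto
  moreover have img: "L s ` vec.span (ws ` {..<r}) = vec.span ((\<lambda>b. L s (ws b)) ` {..<r})" for s
    using vec.linear_span_image[OF lin[of s], of "ws ` {..<r}"] by (simp add: image_image)
  have "(\<lambda>b. L s0 (ws b)) ` {..<r} = us ` {..<r}" using ws(2) by auto
  then have "L s0 ` vec.span (ws ` {..<r}) = L s0 ` W" using img[of s0] us(1) by simp
  ultimately have wsW: "vec.span (ws ` {..<r}) = W"
    using inj_on_image_eq_iff[OF Basis.prems(1), of "vec.span (ws ` {..<r})" W] by blast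
  define g where "g s = F (plucker r (\<lambda>b. L s (ws b)))" for s
  have "polyfun g" unfolding g_def
    by (intro polyfun_homogeneous_poly[OF F] polyfun_plucker pf)
  moreover have "g s0 \<noteq> 0"
    using us(2) plucker_cong[of r "\<lambda>b. L s0 (ws b)" us] ws(2) by (simp add: g_def)
  ultimately have fin: "finite {s. g s = 0}" by (rule polyfun_finite_zeros)
  have "L s ` W \<in> S" if inj: "inj_on (L s) W" and g: "g s \<noteq> 0" for s
  proof -
    have "vec.dim (L s ` W) = r"
      using vec.dim_image_eq[OF lin, of s W] inj dimW subW by (simp add: vec.span_eq_iff[THEN iffD2])
    then have "L s ` W \<in> Gr r" using vec.linear_subspace_image[OF lin subW] by (simp add: Gr_def)
    moreover have "vec.span ((\<lambda>b. L s (ws b)) ` {..<r}) = L s ` W" using img[of s] wsW by simp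
    ultimately show ?thesis using g unfolding S Gr_zeros_def g_def by blast
  qed
  then have "{s. inj_on (L s) W \<and> L s ` W \<notin> S} \<subseteq> {s. g s = 0}" by blast
  then show ?case using fin by (rule finite_subset)
qed

text \<open>Otherwise the open complement of \<open>X\<close> contains the point at 0, hence almost
  all points of the curve, although those with \<open>s \<noteq> 0\<close> lie in
  \<open>X\<close>.\<close>

lemma closedin_zariski_limit:
  fixes L :: "complex \<Rightarrow> 'n cvec \<Rightarrow> ('n::{finite,linorder}) cvec"
  assumes X: "closedin (zariski_Gr r) X" and W: "W \<in> Gr r"
    and lin: "\<And>s. Vector_Spaces.linear (*s) (*s) (L s)" and pf: "\<And>u i. polyfun (\<lambda>s. L s u $ i)"
    and inj: "\<And>s. inj_on (L s) W" and mem: "\<And>s. s \<noteq> 0 \<Longrightarrow> L s ` W \<in> X" and W0: "L 0 ` W \<in> Gr r"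
  shows "L 0 ` W \<in> X"
proof (rule ccontr)
  assume "L 0 ` W \<notin> X"
  then have "finite {s. inj_on (L s) W \<and> L s ` W \<notin> Gr r - X}"
    using X W0 by (intro openin_zariski_curve[OF _ W lin pf inj[of 0]]) (auto simp: closedin_def)
  then have "finite (UNIV - {0 :: complex})" by (rule rev_finite_subset) (use inj mem in auto)
  then show False by (simp add: infinite_UNIV_char_0)
qed

text \<open>The torus multiplies the Pluecker coordinate of \<open>I\<close> by the product of the
  \<open>t $ i\<close> over \<open>I\<close>. This rescaling keeps polynomials homogeneous, so
  preimages of generators are generators.\<close>

lemma openin_zariski_torus_act:
  assumes "openin (zariski_Gr r) S" and t: "t \<in> torus"
  shows "openin (zariski_Gr r) {V \<in> Gr r. torus_act t V \<in> S}"
  using assms(1)[unfolded openin_zariski_iff]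
proof (induction rule: generate_topology_on.induct)
  case Empty
  then show ?case by simp
next
  case (Int a b)
  have eq: "{V \<in> Gr r. torus_act t V \<in> a \<inter> b} = {V \<in> Gr r. torus_act t V \<in> a} \<inter> {V \<in> Gr r. torus_act t V \<in> b}"
    by blast
  show ?case unfolding eq by (rule openin_Int[OF Int.IH])
next
  case (UN K)
  have eq: "{V \<in> Gr r. torus_act t V \<in> \<Union>K} = (\<Union>k\<in>K. {V \<in> Gr r. torus_act t V \<in> k})" by blast
  show ?case unfolding eq by (intro openin_Union) (use UN.IH in blast)
next
  case (Basis S)
  then obtain d F where F: "homogeneous_poly d F" and S: "S = Gr r - Gr_zeros r F" by blast
  define G where "G = (\<lambda>p. F (\<lambda>I. (\<Prod>i\<in>I. t $ i) * p I))"
  have G: "homogeneous_poly d G" unfolding G_def by (rule homogeneous_poly_rescale[OF F])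
  have GF: "G (plucker r vs) = F (plucker r (\<lambda>b. dscale t (vs b)))" for vs
    by (simp add: G_def plucker_dscale[symmetric])
  have span: "vec.span ((\<lambda>b. dscale u (vs b)) ` {..<r}) = torus_act u (vec.span (vs ` {..<r}))" for vs u
    by (simp add: torus_act_span image_image)
  have "torus_act t V \<in> S \<longleftrightarrow> V \<notin> Gr_zeros r G" if V: "V \<in> Gr r" for V
  proof
    assume "torus_act t V \<in> S"
    then obtain us where us: "vec.span (us ` {..<r}) = torus_act t V" "F (plucker r us) \<noteq> 0"
      by (auto simp: S Gr_zeros_def)
    let ?vs = "\<lambda>b. dscale (torus_inv t) (us b)"
    have "(\<lambda>b. dscale t (?vs b)) = us"
      using t by (auto simp: fun_eq_iff Finite_Cartesian_Product.vec_eq_iff torus_def torus_inv_def)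
    moreover have "vec.span (?vs ` {..<r}) = V"
      unfolding span us(1) by (rule torus_act_inv(1)[OF t])
    ultimately show "V \<notin> Gr_zeros r G" using us(2) GF[of ?vs] by (auto simp: Gr_zeros_def)
  next
    assume "V \<notin> Gr_zeros r G"
    then obtain vs where "vec.span (vs ` {..<r}) = V" "G (plucker r vs) \<noteq> 0"
      using V by (auto simp: Gr_zeros_def)
    then have "vec.span ((\<lambda>b. dscale t (vs b)) ` {..<r}) = torus_act t V"
      "F (plucker r (\<lambda>b. dscale t (vs b))) \<noteq> 0" using span GF by auto
    then show "torus_act t V \<in> S"
      using Gr_torus_act[OF t V] unfolding S Gr_zeros_def by blast
  qed
  then have "{V \<in> Gr r. torus_act t V \<in> S} = Gr r - Gr_zeros r G" by blast
  then show ?case using openin_zariski_nonzeros[OF G, of r] by simp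
qed

lemma openin_matroid_basis:
  "openin (zariski_Gr r) {V \<in> Gr r. I \<in> matroid_bases (V :: ('n::{finite,linorder}) cvec set)}"
proof -
  have "{V \<in> Gr r. I \<in> matroid_bases (V :: 'n cvec set)} = Gr r - Gr_zeros r (\<lambda>p. p I)"
  proof -
    have "V \<in> Gr_zeros r (\<lambda>p. p I) \<longleftrightarrow> I \<notin> matroid_bases V" if V: "V \<in> Gr r" for V :: "'n cvec set"
    proof -
      obtain vs where "vec.span (vs ` {..<r}) = V" using Gr_spanning_tuple[OF V] .
      then show ?thesis using plucker_eq_0_iff[OF _ V, of _ I] V by (auto simp: Gr_zeros_def)
    qed
    then show ?thesis by blast
  qed
  then show ?thesis using openin_zariski_nonzeros[OF homogeneous_poly.var[of I], of r] by simp
qed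

subsection \<open>Torus orbit closures\<close>

lemma coord_subspace_basis: "I \<in> matroid_bases (coord_subspace I :: ('n::finite) cvec set)"
  unfolding matroid_bases_def mem_Collect_eq dim_coord_subspace
  by (auto simp: injective_coords_def coord_subspace_def Finite_Cartesian_Product.vec_eq_iff)

lemma torus_act_coord_subspace:
  assumes "t \<in> torus" shows "torus_act t (coord_subspace I) = coord_subspace I"
proof -
  have sub: "torus_act u (coord_subspace I) \<subseteq> coord_subspace I" for u :: "'a cvec"
    by (auto simp: torus_act_dscale coord_subspace_def)
  have "torus_act t (torus_act (torus_inv t) (coord_subspace I)) \<subseteq> torus_act t (coord_subspace I)"
    using sub[of "torus_inv t"] by (auto simp: torus_act_dscale)
  then show ?thesis using sub[of t] torus_act_inv(2)[OF assms] by auto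
qed

lemma orbit_self: "V \<in> torus_orbit V"
proof -
  have "torus_act (torus_inv (\<chi> i. 1)) (torus_act (\<chi> i. 1) V) = V"
    by (rule torus_act_inv(1)) (simp add: torus_def)
  moreover have "dscale (torus_inv (\<chi> i. 1)) (\<chi> i. 1) \<in> (torus :: 'a cvec set)"
    by (simp add: torus_def torus_inv_def)
  ultimately show ?thesis unfolding torus_orbit_def torus_act_mult by (metis imageI)
qed

lemma orbit_Gr: "V \<in> Gr r \<Longrightarrow> torus_orbit V \<subseteq> Gr r"
  by (auto simp: torus_orbit_def Gr_torus_act)

lemma torus_act_orbit: "t \<in> torus \<Longrightarrow> U \<in> torus_orbit V \<Longrightarrow> torus_act t U \<in> torus_orbit V"
  by (auto simp: torus_orbit_def torus_act_mult intro!: imageI torus_mult)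

lemma orbit_subset_invariant: "torus_invariant Y \<Longrightarrow> y \<in> Y \<Longrightarrow> torus_orbit y \<subseteq> Y"
  by (auto simp: torus_invariant_def torus_orbit_def)

lemma orbit_sym:
  assumes "U \<in> torus_orbit V" shows "V \<in> torus_orbit U"
proof -
  obtain t where t: "t \<in> torus" "U = torus_act t V" using assms by (auto simp: torus_orbit_def)
  then have "V = torus_act (torus_inv t) U" by (simp add: torus_act_inv)
  then show ?thesis using torus_inv[OF t(1)] by (auto simp: torus_orbit_def)
qed

text \<open>The limit, as \<open>s\<close> tends to \<open>0\<close>, of the points obtained by scaling the \<open>k\<close>-th coordinate
  by \<open>s ^ h k\<close>.\<close>

lemma degeneration_in_closure:
  fixes V :: "('n::{finite,linorder}) cvec set"
  assumes V: "V \<in> Gr r" and I: "I \<in> matroid_bases V"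
    and h: "\<And>j k. j \<in> I \<Longrightarrow> fund_vec V I j $ k \<noteq> 0 \<Longrightarrow> h j \<le> (h k :: nat)"
    and X: "closedin (zariski_Gr r) X" and orb: "torus_orbit V \<subseteq> X"
  shows "vec.span ((\<lambda>j. \<chi> k. if h k = h j then fund_vec V I j $ k else 0) ` I) \<in> X"
proof -
  define f where "f = fund_vec V I"
  have sub: "vec.subspace V" and dim: "vec.dim V = r" using V by (auto simp: Gr_def)
  have f: "f j \<in> V" "i \<in> I \<Longrightarrow> f j $ i = (if i = j then 1 else 0)" for i j
    unfolding f_def using fund_vec(1,2)[OF sub I] by blast+
  \<comment> \<open>Dividing by \<open>s ^ h j\<close> makes the limit at 0 exist. Truncated
    subtraction is harmless: where \<open>h k < h j\<close> the entry of \<open>f j\<close> is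
    0.\<close>
  define g where "g s j = (\<chi> k. s ^ (h k - h j) * f j $ k)" for s j
  define L where "L s u = (\<Sum>j\<in>I. u $ j *s g s j)" for s u
  have Lk: "L s u $ k = (\<Sum>j\<in>I. u $ j * (s ^ (h k - h j) * f j $ k))" for s u k
    by (simp add: L_def g_def sum_component)
  have lin: "Vector_Spaces.linear (*s) (*s) (L s)" for s
    by unfold_locales
      (simp_all add: Finite_Cartesian_Product.vec_eq_iff Lk algebra_simps sum.distrib sum_distrib_left)
  have pf: "polyfun (\<lambda>s. L s u $ i)" for u i
    unfolding Lk by (intro polyfun_sum polyfun_mult polyfun_const polyfun_power)
  \<comment> \<open>Coordinates in \<open>I\<close> are kept for every \<open>s\<close>, so
    \<open>L s\<close> stays injective on \<open>V\<close> even at 0 and the limit has dimension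
    \<open>r\<close>.\<close>
  have LI: "L s u $ i = u $ i" if i: "i \<in> I" for s u i
  proof -
    have "L s u $ i = (\<Sum>j\<in>I. if i = j then u $ j else 0)"
      unfolding Lk by (intro sum.cong refl) (simp add: f(2)[OF i])
    then show ?thesis using i by simp
  qed
  have inj: "inj_on (L s) V" for s
  proof (rule inj_onI)
    fix u v assume uv: "u \<in> V" "v \<in> V" "L s u = L s v"
    have "u $ i = v $ i" if "i \<in> I" for i using LI[OF that, of s u] LI[OF that, of s v] uv(3) by simp
    then show "u = v" using uv I by (intro injective_coords_eqI[OF sub]) (auto simp: matroid_bases_def)
  qed
  have Lf: "L s (f j) = g s j" if j: "j \<in> I" for s j
  proof -
    have "L s (f j) = (\<Sum>i\<in>I. if i = j then g s i else 0)"
      unfolding L_def by (intro sum.cong refl) (simp add: f(2))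
    then show ?thesis using j by simp
  qed
  have img: "L s ` V = vec.span (g s ` I)" for s
  proof -
    have "L s ` V = vec.span (L s ` f ` I)"
      using vec.linear_span_image[OF lin, of s "f ` I"] span_fund_vec[OF sub I] by (simp add: f_def)
    also have "L s ` f ` I = g s ` I" by (auto simp: Lf image_image)
    finally show ?thesis .
  qed
  have "L s ` V \<in> X" if s: "s \<noteq> 0" for s
  proof -
    define t where "t = (\<chi> k. s ^ h k)"
    have t: "t \<in> torus" using s by (simp add: t_def torus_def)
    have "g s j = inverse (s ^ h j) *s dscale t (f j)" if j: "j \<in> I" for j
    proof -
      have "g s j $ k = (inverse (s ^ h j) *s dscale t (f j)) $ k" for k
      proof (cases "f j $ k = 0")
        case False
        then have "h j \<le> h k" using h[OF j] by (simp add: f_def)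
        then show ?thesis using s by (simp add: g_def t_def power_diff divide_inverse)
      qed (simp add: g_def)
      then show ?thesis by (simp add: Finite_Cartesian_Product.vec_eq_iff)
    qed
    then have "vec.span (g s ` I) = vec.span ((\<lambda>j. dscale t (f j)) ` I)"
      using s by (intro span_image_rescale[of _ "\<lambda>j. inverse (s ^ h j)"]) auto
    also have "\<dots> = torus_act t (vec.span (f ` I))" by (simp add: torus_act_span image_image)
    also have "\<dots> = torus_act t V" using span_fund_vec[OF sub I] by (simp add: f_def)
    finally have "L s ` V = torus_act t V" using img by simp
    then show ?thesis using orb t by (auto simp: torus_orbit_def)
  qed
  moreover have "L 0 ` V \<in> Gr r"
    using vec.dim_image_eq[OF lin, of 0 V] inj dim sub vec.linear_subspace_image[OF lin sub]
    by (simp add: Gr_def vec.span_eq_iff[THEN iffD2])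
  ultimately have "L 0 ` V \<in> X" by (intro closedin_zariski_limit[OF X V lin pf inj])
  moreover have "g 0 j = (\<chi> k. if h k = h j then f j $ k else 0)" if j: "j \<in> I" for j
  proof -
    have "0 ^ (h k - h j) * f j $ k = (if h k = h j then f j $ k else 0)" for k
      using h[OF j, of k] by (cases "f j $ k = 0") (auto simp: f_def power_0_left)
    then show ?thesis by (simp add: g_def)
  qed
  then have "g 0 ` I = (\<lambda>j. \<chi> k. if h k = h j then f j $ k else 0) ` I" by (intro image_cong) auto
  ultimately show ?thesis using img[of 0] unfolding f_def by simp
qed

lemma coord_subspace_in_closure:
  fixes V :: "('n::{finite,linorder}) cvec set"
  assumes V: "V \<in> Gr r" and I: "I \<in> matroid_bases V"
    and X: "closedin (zariski_Gr r) X" and orb: "torus_orbit V \<subseteq> X"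
  shows "coord_subspace I \<in> X"
proof -
  define h :: "'n \<Rightarrow> nat" where "h k = (if k \<in> I then 0 else 1)" for k
  have sub: "vec.subspace V" using V by (simp add: Gr_def)
  have "vec.span ((\<lambda>j. \<chi> k. if h k = h j then fund_vec V I j $ k else 0) ` I) \<in> X"
    by (rule degeneration_in_closure[OF V I _ X orb]) (simp add: h_def)
  moreover have "(\<chi> k. if h k = h j then fund_vec V I j $ k else 0) = axis j 1" if "j \<in> I" for j
    using that fund_vec(2)[OF sub I, of _ j]
    by (auto simp: h_def axis_def Finite_Cartesian_Product.vec_eq_iff)
  then have "(\<lambda>j. \<chi> k. if h k = h j then fund_vec V I j $ k else 0) ` I = (\<lambda>j. axis j 1) ` I"
    by (intro image_cong) auto
  ultimately show ?thesis by (simp add: span_axis)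
qed

lemma closedin_zariski_diff: "openin (zariski_Gr r) S \<Longrightarrow> closedin (zariski_Gr r) (Gr r - S)"
  using closedin_diff[OF closedin_topspace, of "zariski_Gr r" S] by simp

section \<open>Fixed points, invariance and irreducibility of orbit closures\<close>

definition orbit_closure :: "nat \<Rightarrow> ('n::{finite,linorder}) cvec set \<Rightarrow> 'n cvec set set" where
  "orbit_closure r V = zariski_Gr r closure_of torus_orbit V"

lemma closedin_orbit_closure: "closedin (zariski_Gr r) (orbit_closure r V)"
  by (simp add: orbit_closure_def)

lemma orbit_subset_closure: "V \<in> Gr r \<Longrightarrow> torus_orbit V \<subseteq> orbit_closure r V"
  unfolding orbit_closure_def by (rule closure_of_subset) (simp add: orbit_Gr)

lemma orbit_closure_minimal:
  "torus_orbit V \<subseteq> X \<Longrightarrow> closedin (zariski_Gr r) X \<Longrightarrow> orbit_closure r V \<subseteq> X"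
  unfolding orbit_closure_def by (rule closure_of_minimal)

lemma orbit_closure_meets_open:
  assumes "U \<in> orbit_closure r V" "U \<in> S" "openin (zariski_Gr r) S"
  obtains y where "y \<in> torus_orbit V" "y \<in> S"
  using assms unfolding orbit_closure_def in_closure_of by (metis (no_types, lifting))

text \<open>One direction is a degeneration; for the other, having \<open>I\<close> as a basis is an
  open condition and constant on the orbit.\<close>

lemma coord_subspace_in_orbit_closure_iff:
  fixes V :: "('n::{finite,linorder}) cvec set"
  assumes V: "V \<in> Gr r" and I: "card I = r"
  shows "coord_subspace I \<in> orbit_closure r V \<longleftrightarrow> I \<in> matroid_bases V"
proof
  assume "I \<in> matroid_bases V"
  then show "coord_subspace I \<in> orbit_closure r V"
    by (rule coord_subspace_in_closure[OF V _ closedin_orbit_closure orbit_subset_closure[OF V]])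
next
  assume c: "coord_subspace I \<in> orbit_closure r V"
  have "coord_subspace I \<in> {U \<in> Gr r. I \<in> matroid_bases U}"
    using coord_subspace_basis[of I] I by (simp add: Gr_def subspace_coord_subspace dim_coord_subspace)
  from orbit_closure_meets_open[OF c this openin_matroid_basis]
  obtain U where "U \<in> torus_orbit V" "I \<in> matroid_bases U" by blast
  then show "I \<in> matroid_bases V" by (auto simp: torus_orbit_def matroid_bases_torus_act)
qed

lemma coord_subspace_fixed: "coord_subspace I \<in> Z \<Longrightarrow> coord_subspace I \<in> torus_fixed Z"
  by (simp add: torus_fixed_def torus_act_coord_subspace)

lemma torus_fixed_subset: "torus_fixed Z \<subseteq> Z"
  by (auto simp: torus_fixed_def)

lemma torus_invariant_orbit_closure:
  "torus_invariant (orbit_closure r (V :: ('n::{finite,linorder}) cvec set))"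
  unfolding torus_invariant_def
proof (intro ballI)
  fix t :: "'n cvec" and U assume t: "t \<in> torus" and U: "U \<in> orbit_closure r V"
  have UG: "U \<in> Gr r" using U by (simp add: orbit_closure_def in_closure_of)
  have "\<exists>y. y \<in> torus_orbit V \<and> y \<in> S" if S: "torus_act t U \<in> S" "openin (zariski_Gr r) S" for S
  proof -
    have "U \<in> {U \<in> Gr r. torus_act t U \<in> S}" using UG S by simp
    from orbit_closure_meets_open[OF U this openin_zariski_torus_act[OF S(2) t]]
    obtain y where "y \<in> torus_orbit V" "torus_act t y \<in> S" by blast
    then show ?thesis using torus_act_orbit[OF t] by blast
  qed
  then show "torus_act t U \<in> orbit_closure r V"
    using Gr_torus_act[OF t UG] unfolding orbit_closure_def in_closure_of by auto
qed

text \<open>Two points \<open>t\<^sub>1 \<cdot> V\<close> and \<open>t\<^sub>2 \<cdot> V\<close> lie on a curve that runs inside the orbit except at finitely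
  many parameters.\<close>

lemma irreducible_orbit_closure:
  fixes V :: "('n::{finite,linorder}) cvec set"
  assumes V: "V \<in> Gr r"
  shows "irreducible_in (zariski_Gr r) (orbit_closure r V)"
  unfolding irreducible_in_def
proof (intro conjI allI impI)
  show "orbit_closure r V \<noteq> {}" using orbit_subset_closure[OF V] orbit_self by blast
  show "orbit_closure r V \<subseteq> topspace (zariski_Gr r)"
    unfolding orbit_closure_def by (rule closure_of_subset_topspace)
  fix A B assume AB: "closedin (zariski_Gr r) A \<and> closedin (zariski_Gr r) B \<and> orbit_closure r V \<subseteq> A \<union> B"
  have "torus_orbit V \<subseteq> A \<or> torus_orbit V \<subseteq> B"
  proof (rule ccontr)
    assume "\<not> (torus_orbit V \<subseteq> A \<or> torus_orbit V \<subseteq> B)"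
    then obtain t1 t2 where t: "t1 \<in> torus" "t2 \<in> torus" "torus_act t1 V \<notin> A" "torus_act t2 V \<notin> B"
      by (auto simp: torus_orbit_def)
    \<comment> \<open>The segment from \<open>t1\<close> to \<open>t2\<close> starts outside
      \<open>A\<close>, ends outside \<open>B\<close>, and leaves the torus only where a coordinate
      polynomial vanishes. Almost every parameter therefore gives an orbit point outside
      both.\<close>
    define T where "T s = (\<chi> i. (1 - s) * t1 $ i + s * t2 $ i)" for s
    have T01: "T 0 = t1" "T 1 = t2" by (auto simp: T_def Finite_Cartesian_Product.vec_eq_iff)
    have Tpf: "polyfun (\<lambda>s. T s $ i)" for i
    proof -
      have "polyfun (\<lambda>s. t1 $ i + s * (t2 $ i - t1 $ i))" by (intro polyfun_add polyfun_mult) auto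
      then show ?thesis by (simp add: T_def algebra_simps)
    qed
    have pf: "polyfun (\<lambda>s. dscale (T s) u $ i)" for u i
      unfolding dscale_nth by (intro polyfun_mult Tpf polyfun_const)
    have inj: "inj_on (dscale (T s)) V" if "T s \<in> torus" for s
      using inj_dscale[OF that] by (rule inj_on_subset) simp
    have op: "openin (zariski_Gr r) (Gr r - A)" "openin (zariski_Gr r) (Gr r - B)"
      using AB by (auto simp: closedin_def)
    have "finite {s. inj_on (dscale (T s)) V \<and> dscale (T s) ` V \<notin> Gr r - A}"
    proof (rule openin_zariski_curve[OF op(1) V linear_dscale pf])
      show "inj_on (dscale (T 0)) V" using inj[of 0] T01 t by simp
      show "dscale (T 0) ` V \<in> Gr r - A"
        using t T01 Gr_torus_act[OF t(1) V] by (simp add: torus_act_dscale)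
    qed
    moreover have "finite {s. inj_on (dscale (T s)) V \<and> dscale (T s) ` V \<notin> Gr r - B}"
    proof (rule openin_zariski_curve[OF op(2) V linear_dscale pf])
      show "inj_on (dscale (T 1)) V" using inj[of 1] T01 t by simp
      show "dscale (T 1) ` V \<in> Gr r - B"
        using t T01 Gr_torus_act[OF t(2) V] by (simp add: torus_act_dscale)
    qed
    moreover have "finite {s. T s $ i = 0}" for i
      using t(1) by (intro polyfun_finite_zeros[OF Tpf, of 0]) (simp add: T01 torus_def)
    then have "finite (\<Union>i. {s. T s $ i = 0})" by simp
    ultimately have "finite ({s. inj_on (dscale (T s)) V \<and> dscale (T s) ` V \<notin> Gr r - A} \<union>
      {s. inj_on (dscale (T s)) V \<and> dscale (T s) ` V \<notin> Gr r - B} \<union> (\<Union>i. {s. T s $ i = 0}))" by simp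
    from ex_new_if_finite[OF infinite_UNIV_char_0 this]
    obtain s where s: "\<not> (inj_on (dscale (T s)) V \<and> dscale (T s) ` V \<notin> Gr r - A)"
      "\<not> (inj_on (dscale (T s)) V \<and> dscale (T s) ` V \<notin> Gr r - B)" "\<And>i. T s $ i \<noteq> 0" by blast
    have Ts: "T s \<in> torus" using s(3) by (simp add: torus_def)
    then have "torus_act (T s) V \<notin> A \<union> B" using s(1,2) inj[OF Ts] by (simp add: torus_act_dscale)
    moreover have "torus_act (T s) V \<in> torus_orbit V" using Ts by (auto simp: torus_orbit_def)
    ultimately show False using AB orbit_subset_closure[OF V] by blast
  qed
  then show "orbit_closure r V \<subseteq> A \<or> orbit_closure r V \<subseteq> B"
    using orbit_closure_minimal AB by blast
qed

lemma orbit_closure_subvariety: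
  "V \<in> Gr r \<Longrightarrow> torus_invariant_subvariety r (orbit_closure r V)"
  by (simp add: torus_invariant_subvariety_def closedin_orbit_closure irreducible_orbit_closure
      torus_invariant_orbit_closure)

lemma matroid_bases_subset_if_fixed_subset:
  assumes V: "V \<in> Gr r" and Y: "closedin (zariski_Gr r) Y" "torus_invariant Y"
    and fixed: "torus_fixed Y \<subseteq> torus_fixed (orbit_closure r V)" and y: "y \<in> Y"
  shows "matroid_bases y \<subseteq> matroid_bases V"
proof
  fix I assume I: "I \<in> matroid_bases y"
  have yG: "y \<in> Gr r" using Y(1) y closedin_subset by fastforce
  have "coord_subspace I \<in> Y"
    by (rule coord_subspace_in_closure[OF yG I Y(1) orbit_subset_invariant[OF Y(2) y]])
  then have "coord_subspace I \<in> torus_fixed (orbit_closure r V)"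
    using subsetD[OF fixed coord_subspace_fixed] by simp
  then have "coord_subspace I \<in> orbit_closure r V" by (rule subsetD[OF torus_fixed_subset])
  moreover have "card I = r" using I yG by (simp add: matroid_bases_def Gr_def)
  ultimately show "I \<in> matroid_bases V" using coord_subspace_in_orbit_closure_iff[OF V] by blast
qed

lemma subvariety_eq_orbit_closure:
  fixes V :: "('n::{finite,linorder}) cvec set"
  assumes V: "V \<in> Gr r"
    and rigid: "\<And>y. y \<in> Gr r \<Longrightarrow> matroid_bases y = matroid_bases V \<Longrightarrow> y \<in> torus_orbit V"
    and Y: "torus_invariant_subvariety r Y" and fixed: "torus_fixed Y = torus_fixed (orbit_closure r V)"
  shows "Y = orbit_closure r V"
proof -
  have cl: "closedin (zariski_Gr r) Y" and inv: "torus_invariant Y" and irr: "irreducible_in (zariski_Gr r) Y"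
    using Y by (auto simp: torus_invariant_subvariety_def)
  have YG: "Y \<subseteq> Gr r" using cl closedin_subset by fastforce
  have sub: "matroid_bases y \<subseteq> matroid_bases V" if "y \<in> Y" for y
    by (rule matroid_bases_subset_if_fixed_subset[OF V cl inv _ that]) (simp add: fixed)
  have irrD: "Y \<subseteq> A \<or> Y \<subseteq> B" if "closedin (zariski_Gr r) A" "closedin (zariski_Gr r) B" "Y \<subseteq> A \<union> B" for A B
    using irr that unfolding irreducible_in_def by blast
  \<comment> \<open>Each \<open>D {I}\<close> with \<open>I\<close> a basis of \<open>V\<close>
    meets \<open>Y\<close> in the fixed point \<open>coord_subspace I\<close>. Irreducibility lets
    these finitely many open sets meet \<open>Y\<close> simultaneously, which produces the generic
    point.\<close>
  define D where "D F = {U \<in> Gr r. F \<subseteq> matroid_bases (U :: 'n cvec set)}" for F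
  have D: "openin (zariski_Gr r) (D F) \<and> (F \<subseteq> matroid_bases V \<longrightarrow> Y \<inter> D F \<noteq> {})" for F
  proof (induction F rule: infinite_finite_induct)
    case (infinite F) then show ?case by simp
  next
    case empty
    have "D {} = Gr r" by (simp add: D_def)
    then show ?case using irr YG openin_topspace[of "zariski_Gr r :: 'n cvec set topology"]
      by (auto simp: irreducible_in_def)
  next
    case (insert I F)
    have DI: "openin (zariski_Gr r) (D {I})" using openin_matroid_basis[of r I] by (simp add: D_def)
    have eq: "D (insert I F) = D {I} \<inter> D F" by (auto simp: D_def)
    have op: "openin (zariski_Gr r) (D (insert I F))" unfolding eq using DI insert.IH by (intro openin_Int) auto
    moreover have "Y \<inter> D (insert I F) \<noteq> {}" if IF: "insert I F \<subseteq> matroid_bases V"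
    proof
      assume e: "Y \<inter> D (insert I F) = {}"
      have "card I = r" using IF V by (auto simp: matroid_bases_def Gr_def)
      then have "coord_subspace I \<in> orbit_closure r V"
        using coord_subspace_in_orbit_closure_iff[OF V] IF by blast
      then have "coord_subspace I \<in> torus_fixed Y" unfolding fixed by (rule coord_subspace_fixed)
      then have "coord_subspace I \<in> Y" by (rule subsetD[OF torus_fixed_subset])
      then have "coord_subspace I \<in> Y \<inter> D {I}" using YG coord_subspace_basis[of I] by (auto simp: D_def)
      moreover have "Y \<inter> D F \<noteq> {}" using insert.IH IF by blast
      moreover have "Y \<subseteq> (Gr r - D {I}) \<union> (Gr r - D F)" using e YG unfolding eq by blast
      moreover have "closedin (zariski_Gr r) (Gr r - D {I})" "closedin (zariski_Gr r) (Gr r - D F)"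
        using DI insert.IH by (blast intro: closedin_zariski_diff)+
      ultimately show False using irrD[of "Gr r - D {I}" "Gr r - D F"] by blast
    qed
    ultimately show ?case by blast
  qed
  let ?D = "D (matroid_bases V)"
  have DO: "y \<in> torus_orbit V" if "y \<in> Y" "y \<in> ?D" for y
    using that sub[OF that(1)] by (intro rigid) (auto simp: D_def)
  obtain y where y: "y \<in> Y" "y \<in> ?D" using D[of "matroid_bases V"] by blast
  have "V \<in> Y" using orbit_sym[OF DO[OF y]] orbit_subset_invariant[OF inv y(1)] by blast
  then have "orbit_closure r V \<subseteq> Y" by (intro orbit_closure_minimal[OF _ cl] orbit_subset_invariant[OF inv])
  \<comment> \<open>The part of \<open>Y\<close> inside \<open>?D\<close> lies in the orbit of
    \<open>V\<close>, so two closed sets cover \<open>Y\<close>, and the generic point rules out the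
    second.\<close>
  moreover have "Y \<subseteq> orbit_closure r V \<or> Y \<subseteq> Gr r - ?D"
  proof (rule irrD[OF closedin_orbit_closure])
    show "closedin (zariski_Gr r) (Gr r - ?D)"
      using D[of "matroid_bases V"] by (blast intro: closedin_zariski_diff)
    show "Y \<subseteq> orbit_closure r V \<union> (Gr r - ?D)" using DO orbit_subset_closure[OF V] YG by blast
  qed
  ultimately show ?thesis using y by blast
qed

subsection \<open>Exchange cycles\<close>

text \<open>The submatrix with rows \<open>x b\<close> and columns \<open>y b\<close> is triangular
  with nonzero diagonal, so the \<open>x b\<close> can replace the \<open>y b\<close>. In index
  order, each equation at \<open>x b\<close> isolates the coordinate at \<open>y b\<close>.\<close>

lemma path_elimination:
  fixes W :: "('n::finite) cvec set" and x y :: "nat \<Rightarrow> 'n"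
  assumes W: "vec.subspace W" and I: "I \<in> matroid_bases W" and yI: "y ` S \<subseteq> I"
    and diag: "\<And>b. b \<in> S \<Longrightarrow> fund_vec W I (y b) $ x b \<noteq> 0"
    and off: "\<And>a b. a \<in> S \<Longrightarrow> b \<in> S \<Longrightarrow> fund_vec W I (y a) $ x b \<noteq> 0 \<Longrightarrow> a = b \<or> b = Suc a"
  shows "injective_coords ((I - y ` S) \<union> x ` S) W"
  unfolding injective_coords_def
proof (intro ballI impI)
  fix v assume v: "v \<in> W" "\<forall>i\<in>(I - y ` S) \<union> x ` S. v $ i = 0"
  have vy: "v $ y b = 0" if "b \<in> S" for b
    using that
  proof (induction b rule: less_induct)
    case (less b)
    let ?t = "\<lambda>l. v $ l * fund_vec W I l $ x b"
    have zero: "?t l = 0" if l: "l \<in> I - {y b}" for l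
    proof (cases "l \<in> y ` S")
      case True
      then obtain a where a: "a \<in> S" "l = y a" by blast
      then have "a \<noteq> b" using l by blast
      then show ?thesis using off[OF a(1) less.prems] less.IH[of a] a by auto
    next
      case False
      then show ?thesis using v(2) l by simp
    qed
    have "0 = v $ x b" using v(2) less.prems by simp
    also have "\<dots> = (\<Sum>l\<in>I. v $ l *s fund_vec W I l) $ x b" using fund_vec_expansion[OF W I v(1)] by argo
    also have "\<dots> = (\<Sum>l\<in>I. ?t l)" by (simp add: sum_component)
    also have "\<dots> = ?t (y b) + (\<Sum>l\<in>I - {y b}. ?t l)"
      using yI less.prems by (intro sum.remove) auto
    also have "(\<Sum>l\<in>I - {y b}. ?t l) = 0" by (intro sum.neutral ballI zero)
    also have "?t (y b) + 0 = ?t (y b)" by simp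
    finally show ?case using diag[OF less.prems] by simp
  qed
  have vI: "v $ i = 0" if "i \<in> I" for i
  proof (cases "i \<in> y ` S")
    case True then show ?thesis using vy by blast
  next
    case False then show ?thesis using v(2) that by simp
  qed
  have "injective_coords I W" using I by (simp add: matroid_bases_def)
  then show "v = 0" by (rule injective_coords_eqI[OF W _ v(1) vec.subspace_0[OF W]]) (simp add: vI)
qed

locale exchange_graph =
  fixes V U :: "('n::finite) cvec set" and I :: "'n set"
  assumes subV: "vec.subspace V" and subU: "vec.subspace U"
    and uni: "unimodular V" and IU: "I \<in> matroid_bases U" and UV: "matroid_bases U \<subseteq> matroid_bases V"
begin

definition A where "A i j = fund_vec V I j $ i"
definition B where "B i j = fund_vec U I j $ i"

text \<open>An arc from \<open>a\<close> to \<open>b\<close> encodes the demand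
  \<open>h a \<le> h b\<close>. Entries of \<open>V\<close> give arcs out of \<open>I\<close>;
  entries of \<open>U\<close> add the reverse arcs, which forces equality on the support of
  \<open>U\<close>.\<close>

definition E where
  "E = {(j, i). j \<in> I \<and> i \<notin> I \<and> A i j \<noteq> 0} \<union> {(i, j). j \<in> I \<and> i \<notin> I \<and> B i j \<noteq> 0}"

lemma IV: "I \<in> matroid_bases V" using IU UV by blast

lemma B_imp_A: "j \<in> I \<Longrightarrow> i \<notin> I \<Longrightarrow> B i j \<noteq> 0 \<Longrightarrow> A i j \<noteq> 0"
  unfolding A_def B_def basis_exchange_iff[OF subV IV] basis_exchange_iff[OF subU IU] using UV by blast

lemma A_sign: "j \<in> I \<Longrightarrow> A i j \<in> {0, 1, -1}"
  unfolding A_def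
  by (rule unimodularD[OF uni _ _ fund_vec(1)[OF subV IV]])
    (use IV fund_vec(2)[OF subV IV] in \<open>auto simp: matroid_bases_def\<close>)

lemma A_I: "i \<in> I \<Longrightarrow> A i j = (if i = j then 1 else 0)"
  unfolding A_def by (rule fund_vec(2)[OF subV IV])

text \<open>Along a shortest closed walk through an arc \<open>j \<rightarrow> i\<close> that is lost when passing from \<open>V\<close> to
  \<open>U\<close>, the matrix of \<open>V\<close> is that of a chordless cycle. Unimodularity makes its determinant vanish,
  whereas the corresponding minor of \<open>U\<close> is a product of nonzero entries.\<close>

lemma no_chordless_cycle:
  fixes x y :: "nat \<Rightarrow> 'n"
  assumes y: "inj_on y {..k}" "\<And>a. a \<le> k \<Longrightarrow> y a \<in> I" and x: "inj_on x {..k}" "\<And>a. a \<le> k \<Longrightarrow> x a \<notin> I"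
    and diag: "\<And>a. a \<le> k \<Longrightarrow> B (x a) (y a) \<noteq> 0"
    and sub: "\<And>a. a < k \<Longrightarrow> A (x (Suc a)) (y a) \<noteq> 0"
    and last: "A (x 0) (y k) \<noteq> 0" "B (x 0) (y k) = 0"
    and chordless: "\<And>a b. a \<le> k \<Longrightarrow> b \<le> k \<Longrightarrow> A (x a) (y b) \<noteq> 0 \<Longrightarrow> a = b \<or> a = Suc b \<or> (a = 0 \<and> b = k)"
  shows False
proof -
  have k: "k \<noteq> 0"
  proof
    assume "k = 0"
    then show False using diag[of 0] last(2) by simp
  qed
  have diagA: "A (x a) (y a) \<noteq> 0" if "a \<le> k" for a using B_imp_A[OF y(2) x(2) diag] that by blast
  define f where "f = fund_vec V I"
  \<comment> \<open>The coefficients make \<open>u\<close> cancel at \<open>x 1\<close>, ...,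
    \<open>x k\<close>. They are signs because the entries of \<open>A\<close> along the cycle
    are.\<close>
  define \<epsilon> where "\<epsilon> = rec_nat (1::complex) (\<lambda>a e. - A (x (Suc a)) (y a) * e / A (x (Suc a)) (y (Suc a)))"
  have \<epsilon>0: "\<epsilon> 0 = 1" and \<epsilon>S: "\<epsilon> (Suc a) = - A (x (Suc a)) (y a) * \<epsilon> a / A (x (Suc a)) (y (Suc a))" for a
    by (simp_all add: \<epsilon>_def)
  have sgnA: "A (x a) (y b) = 1 \<or> A (x a) (y b) = -1" if "a \<le> k" "b \<le> k" "A (x a) (y b) \<noteq> 0" for a b
    using A_sign[OF y(2)[OF that(2)], of "x a"] that(3) by auto
  have \<epsilon>sgn: "a \<le> k \<Longrightarrow> \<epsilon> a = 1 \<or> \<epsilon> a = -1" for a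
  proof (induction a)
    case (Suc a)
    then show ?case
      using sgnA[of "Suc a" a] sgnA[of "Suc a" "Suc a"] sub[of a] diagA[of "Suc a"]
      by (auto simp: \<epsilon>S)
  qed (simp add: \<epsilon>0)
  define u where "u = (\<Sum>a\<le>k. \<epsilon> a *s f (y a))"
  have uV: "u \<in> V"
    unfolding u_def f_def using subV fund_vec(1)[OF subV IV] by (intro vec.subspace_sum vec.subspace_scale)
  have uk: "u $ l = (\<Sum>a\<le>k. \<epsilon> a * A l (y a))" for l by (simp add: u_def f_def A_def sum_component)
  have uy: "u $ y b = \<epsilon> b" if b: "b \<le> k" for b
  proof -
    have "u $ y b = (\<Sum>a\<le>k. if a = b then \<epsilon> a else 0)"
      unfolding uk using y b by (intro sum.cong refl) (auto simp: A_I inj_on_eq_iff)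
    then show ?thesis using b by simp
  qed
  have uI: "u $ l = 0" if "l \<in> I" "l \<notin> y ` {..k}" for l
    unfolding uk using that by (intro sum.neutral) (auto simp: A_I)
  have uS: "u $ x (Suc b) = 0" if b: "b < k" for b
  proof -
    have "u $ x (Suc b) = (\<Sum>a\<in>{b, Suc b}. \<epsilon> a * A (x (Suc b)) (y a))"
      unfolding uk using b chordless[of "Suc b"] by (intro sum.mono_neutral_right) auto
    also have "\<dots> = 0" using diagA[of "Suc b"] b by (simp add: \<epsilon>S)
    finally show ?thesis .
  qed
  have "u $ x 0 = (\<Sum>a\<in>{0, k}. \<epsilon> a * A (x 0) (y a))"
    unfolding uk using chordless[of 0] by (intro sum.mono_neutral_right) auto
  also have "\<dots> = A (x 0) (y 0) + \<epsilon> k * A (x 0) (y k)" using k by (simp add: \<epsilon>0)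
  finally have "u $ x 0 \<in> {0, 2, -2}"
    using sgnA[of 0 0] sgnA[of 0 k] diagA[of 0] last(1) \<epsilon>sgn[of k] by auto
  \<comment> \<open>In \<open>U\<close> the closing entry is lost and the whole cycle becomes
    triangular, so \<open>?I1\<close> is a basis of \<open>U\<close> and hence of \<open>V\<close>.
    This forbids \<open>u\<close> to vanish at \<open>x 0\<close> as well.\<close>
  let ?I1 = "(I - y ` {..k}) \<union> x ` {..k}"
  have "injective_coords ?I1 U"
  proof (rule path_elimination[OF subU IU])
    show "y ` {..k} \<subseteq> I" using y(2) by auto
    show "fund_vec U I (y b) $ x b \<noteq> 0" if "b \<in> {..k}" for b using diag that by (simp add: B_def)
    fix a b assume ab: "a \<in> {..k}" "b \<in> {..k}" "fund_vec U I (y a) $ x b \<noteq> 0"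
    then have "B (x b) (y a) \<noteq> 0" by (simp add: B_def)
    moreover from this have "A (x b) (y a) \<noteq> 0" using B_imp_A[OF y(2) x(2)] ab by auto
    ultimately show "a = b \<or> b = Suc a" using chordless[of b a] ab last(2) by auto
  qed
  moreover have "card ?I1 = vec.dim U"
  proof -
    have yk: "y ` {..k} \<subseteq> I" using y(2) by auto
    have "x ` {..k} \<inter> (I - y ` {..k}) = {}" using x(2) by auto
    then have "card ?I1 = card (I - y ` {..k}) + card (x ` {..k})" by (intro card_Un_disjoint) auto
    also have "card (I - y ` {..k}) = card I - card (y ` {..k})" using yk by (intro card_Diff_subset) auto
    also have "card (x ` {..k}) = card (y ` {..k})" by (simp only: card_image[OF x(1)] card_image[OF y(1)])
    also have "card I - card (y ` {..k}) + card (y ` {..k}) = card I"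
      using card_mono[OF _ yk] by (intro le_add_diff_inverse2) auto
    finally show ?thesis using IU by (simp add: matroid_bases_def)
  qed
  ultimately have "?I1 \<in> matroid_bases V" using UV by (auto simp: matroid_bases_def)
  then have injV: "injective_coords ?I1 V" by (simp add: matroid_bases_def)
  have nz: "u $ x 0 \<noteq> 0"
  proof
    assume "u $ x 0 = 0"
    then have ux: "u $ x b = 0" if "b \<le> k" for b using uS that by (cases b) auto
    have "u $ i = 0" if "i \<in> ?I1" for i
      using that
    proof
      assume "i \<in> I - y ` {..k}" then show ?thesis using uI by simp
    next
      assume "i \<in> x ` {..k}" then show ?thesis using ux by auto
    qed
    then have "u = 0" by (rule injective_coordsD[OF injV uV])
    then show False using uy[of 0] by (simp add: \<epsilon>0)
  qed
  \<comment> \<open>Leaving out index 0 opens the cycle, so the matrix of \<open>V\<close> is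
    triangular too, and \<open>u\<close> is the indicator of \<open>y 0\<close> on
    \<open>?I2\<close>. Unimodularity then excludes the values 2 and -2.\<close>
  let ?I2 = "(I - y ` {1..k}) \<union> x ` {1..k}"
  have "injective_coords ?I2 V"
  proof (rule path_elimination[OF subV IV])
    show "y ` {1..k} \<subseteq> I" using y(2) by auto
    show "fund_vec V I (y b) $ x b \<noteq> 0" if "b \<in> {1..k}" for b using diagA[of b] that by (simp add: A_def)
    show "a = b \<or> b = Suc a" if "a \<in> {1..k}" "b \<in> {1..k}" "fund_vec V I (y a) $ x b \<noteq> 0" for a b
      using chordless[of b a] that by (auto simp: A_def)
  qed
  moreover have "y 0 \<in> ?I2" using y by (auto simp: inj_on_eq_iff)
  moreover have "u $ l = (if l = y 0 then 1 else 0)" if l: "l \<in> ?I2" for l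
  proof (cases "l \<in> I")
    case True
    then have l1: "l \<notin> y ` {1..k}" using l x(2) by auto
    show ?thesis
    proof (cases "l \<in> y ` {..k}")
      case True
      then obtain a where a: "a \<le> k" "l = y a" by blast
      then have "a = 0" using l1 by (cases a) auto
      then show ?thesis using a uy[of 0] by (simp add: \<epsilon>0)
    next
      case False
      then show ?thesis using uI True by auto
    qed
  next
    case False
    then obtain b where b: "b \<in> {1..k}" "l = x b" using l by blast
    then have "u $ l = 0" using uS[of "b - 1"] by auto
    then show ?thesis using False y(2)[of 0] by auto
  qed
  ultimately have "u $ x 0 \<in> {0, 1, -1}" by (intro unimodularD[OF uni _ _ uV])
  then show False using nz \<open>u $ x 0 \<in> {0, 2, -2}\<close> by auto
qed

lemma E_alternates: "(a, b) \<in> E \<Longrightarrow> a \<in> I \<longleftrightarrow> b \<notin> I"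
  by (auto simp: E_def)

text \<open>The minimum is taken over all lost arcs and all return walks at once, because a chord of
  the walk may itself be a lost arc.\<close>

lemma no_cycle:
  assumes "j \<in> I" "i \<notin> I" "A i j \<noteq> 0" "B i j = 0"
  shows "(i, j) \<notin> E\<^sup>*"
proof
  assume "(i, j) \<in> E\<^sup>*"
  define P where "P m \<longleftrightarrow> (\<exists>i j. j \<in> I \<and> i \<notin> I \<and> A i j \<noteq> 0 \<and> B i j = 0 \<and> (i, j) \<in> E ^^ m)" for m
  obtain m0 where "P m0" using assms \<open>(i, j) \<in> E\<^sup>*\<close> rtrancl_imp_relpow[of "(i, j)" E] unfolding P_def by blast
  define m where "m = (LEAST m. P m)"
  have Pm: "P m" unfolding m_def by (rule LeastI[of P, OF \<open>P m0\<close>])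
  have least: "m \<le> m'" if "P m'" for m' unfolding m_def by (rule Least_le[of P, OF that])
  obtain i j where ij: "j \<in> I" "i \<notin> I" "A i j \<noteq> 0" "B i j = 0" "(i, j) \<in> E ^^ m"
    using Pm unfolding P_def by blast
  have short: "m \<le> m'" if "(i, j) \<in> E ^^ m'" for m' using least[of m'] ij that unfolding P_def by blast
  obtain p where p: "p 0 = i" "p m = j" "\<And>t. t < m \<Longrightarrow> (p t, p (Suc t)) \<in> E"
    using ij(5) unfolding relpow_fun_conv by blast
  have sub: "(p s, p t) \<in> E ^^ (t - s)" if "s \<le> t" "t \<le> m" for s t
    unfolding relpow_fun_conv using p(3) that by (intro exI[of _ "\<lambda>n. p (s + n)"]) auto
  have shortcut: "m \<le> s + n + (m - t)" if "s \<le> m" "t \<le> m" "(p s, p t) \<in> E ^^ n" for s t n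
  proof (rule short)
    have "(i, p t) \<in> E ^^ (s + n)" using sub[of 0 s] that p(1) unfolding relpow_add by auto
    then show "(i, j) \<in> E ^^ (s + n + (m - t))" using sub[of t m] that p(2) unfolding relpow_add by auto
  qed
  have inj: "inj_on p {..m}"
  proof (rule linorder_inj_onI)
    fix s t assume "s < t" "s \<in> {..m}" "t \<in> {..m}"
    then show "p s \<noteq> p t" using shortcut[of s t 0] by auto
  qed auto
  have par: "p t \<in> I \<longleftrightarrow> odd t" if "t \<le> m" for t
    using that
  proof (induction t)
    case (Suc t)
    then show ?case using E_alternates[OF p(3)[of t]] by auto
  qed (use ij p in simp)
  \<comment> \<open>Arcs alternate between \<open>I\<close> and its complement; the even vertices of
    the walk become the \<open>x a\<close> and the odd ones the \<open>y a\<close>.\<close>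
  have "odd m" using par[of m] p(2) ij(1) by simp
  then obtain k where m: "m = 2 * k + 1" by (elim oddE)
  define x where "x a = p (2 * a)" for a
  define y where "y a = p (2 * a + 1)" for a
  have yI: "y a \<in> I" and xI: "x a \<notin> I" if "a \<le> k" for a using par that by (auto simp: x_def y_def m)
  have EB: "B (x a) (y b) \<noteq> 0" if "(x a, y b) \<in> E" "a \<le> k" for a b using that xI by (auto simp: E_def)
  have EA: "A (x a) (y b) \<noteq> 0" if "(y b, x a) \<in> E" "a \<le> k" for a b using that xI by (auto simp: E_def)
  show False
  proof (rule no_chordless_cycle[of y k x])
    have "p (2 * a) \<noteq> p (2 * b)" "p (2 * a + 1) \<noteq> p (2 * b + 1)" if "a \<le> k" "b \<le> k" "a \<noteq> b" for a b
      using inj_on_eq_iff[OF inj, of "2 * a" "2 * b"] inj_on_eq_iff[OF inj, of "2 * a + 1" "2 * b + 1"] that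
      by (simp_all add: m)
    then show "inj_on y {..k}" "inj_on x {..k}" unfolding inj_on_def x_def y_def by blast+
    show "B (x a) (y a) \<noteq> 0" if "a \<le> k" for a
      using EB[of a a] p(3)[of "2 * a"] that by (simp add: x_def y_def m)
    show "A (x (Suc a)) (y a) \<noteq> 0" if "a < k" for a
      using EA[of a "Suc a"] p(3)[of "2 * a + 1"] that by (simp add: x_def y_def m)
    show "A (x 0) (y k) \<noteq> 0" "B (x 0) (y k) = 0" using ij p by (simp_all add: x_def y_def m)
    fix a b assume ab: "a \<le> k" "b \<le> k" and nz: "A (x a) (y b) \<noteq> 0"
    have arc: "(y b, x a) \<in> E" using nz yI[OF ab(2)] xI[OF ab(1)] by (simp add: E_def)
    show "a = b \<or> a = Suc b \<or> (a = 0 \<and> b = k)"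
    proof (rule ccontr)
      assume c: "\<not> (a = b \<or> a = Suc b \<or> (a = 0 \<and> b = k))"
      show False
      \<comment> \<open>For \<open>b < a\<close> the chord from \<open>y b\<close> to
        \<open>x a\<close> skips part of the walk. Otherwise it points backward: if it is lost, it
        has a shorter return walk; if it survives in \<open>U\<close>, its reverse arc is a
        shortcut.\<close>
      proof (cases "b < a")
        case True
        then show False
          using shortcut[of "2 * b + 1" "2 * a" 1] arc c ab by (auto simp: x_def y_def m)
      next
        case False
        show False
        proof (cases "B (x a) (y b) = 0")
          case True
          have "(x a, y b) \<in> E ^^ (2 * b + 1 - 2 * a)"
            using sub[of "2 * a" "2 * b + 1"] False ab by (simp add: x_def y_def m)
          then have "P (2 * b + 1 - 2 * a)"
            unfolding P_def using True nz yI[OF ab(2)] xI[OF ab(1)] by blast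
          then show False using least[of "2 * b + 1 - 2 * a"] False c ab by (auto simp: m)
        next
          case B: False
          then have "(x a, y b) \<in> E" using yI[OF ab(2)] xI[OF ab(1)] by (simp add: E_def)
          then show False
            using shortcut[of "2 * a" "2 * b + 1" 1] False c ab by (auto simp: x_def y_def m)
        qed
      qed
    qed
  qed (use yI xI in auto)
qed

text \<open>The height counts the vertices from which \<open>k\<close> is reachable, so it is
  monotone along arcs. On the support of \<open>U\<close> both arcs exist and heights agree. A lost
  arc from \<open>j\<close> to \<open>k\<close> raises the height strictly, since \<open>k\<close>
  reaches itself but not \<open>j\<close>.\<close>

lemma height_function:
  "\<exists>h :: 'n \<Rightarrow> nat. \<forall>j\<in>I. \<forall>k. (A k j \<noteq> 0 \<longrightarrow> h j \<le> h k) \<and>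
     ((h k = h j \<and> A k j \<noteq> 0) \<longleftrightarrow> B k j \<noteq> 0)"
proof -
  define h where "h k = card {l. (l, k) \<in> E\<^sup>*}" for k
  have mono: "h j \<le> h k" if "(j, k) \<in> E\<^sup>*" for j k
    unfolding h_def using that by (intro card_mono) (auto intro: rtrancl_trans)
  have BI: "B k j = (if k = j then 1 else 0)" if "k \<in> I" for k j
    unfolding B_def by (rule fund_vec(2)[OF subU IU that])
  have 1: "h j \<le> h k" if j: "j \<in> I" and nz: "A k j \<noteq> 0" for j k
  proof (cases "k \<in> I")
    case True then show ?thesis using A_I[of k j] nz by (auto split: if_splits)
  next
    case False
    then have "(j, k) \<in> E" using j nz by (simp add: E_def)
    then show ?thesis by (intro mono) auto
  qed
  moreover have "(h k = h j \<and> A k j \<noteq> 0) \<longleftrightarrow> B k j \<noteq> 0" if j: "j \<in> I" for j k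
  proof (cases "k \<in> I")
    case True then show ?thesis using A_I[of k j] BI[of k j] by auto
  next
    case False
    show ?thesis
    proof
      assume B: "B k j \<noteq> 0"
      then have "(k, j) \<in> E" using False j by (simp add: E_def)
      then have "h k \<le> h j" by (intro mono) auto
      then show "h k = h j \<and> A k j \<noteq> 0" using 1[OF j, of k] B_imp_A[OF j False B] by auto
    next
      assume h: "h k = h j \<and> A k j \<noteq> 0"
      show "B k j \<noteq> 0"
      proof
        assume "B k j = 0"
        then have n: "(k, j) \<notin> E\<^sup>*" using no_cycle[OF j False] h by blast
        have "(j, k) \<in> E" using h j False by (simp add: E_def)
        then have "{l. (l, j) \<in> E\<^sup>*} \<subset> {l. (l, k) \<in> E\<^sup>*}"
          using n by (auto intro: rtrancl_into_rtrancl)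
        then have "h j < h k" unfolding h_def by (intro psubset_card_mono) auto
        then show False using h by simp
      qed
    qed
  qed
  ultimately show ?thesis by (intro exI[of _ h]) blast
qed

end

subsection \<open>Orbit closures in the quasisymmetric Grassmannian\<close>

lemma forest_frame_orbit:
  assumes "forest_frame C \<rho> v" "\<And>c k. c \<in> C \<Longrightarrow> u c $ k = 0 \<longleftrightarrow> v c $ k = 0"
  shows "vec.span (u ` C) \<in> torus_orbit (vec.span (v ` C))"
proof -
  have "order_forest C v" using assms(1) by (simp add: forest_frame_def)
  from order_forest_torus_equivalent[OF _ this, of u]
  obtain \<sigma> where "\<sigma> \<in> torus" "vec.span (u ` C) = torus_act \<sigma> (vec.span (v ` C))"
    using assms(2) by auto
  then show ?thesis by (auto simp: torus_orbit_def)
qed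

text \<open>In the basis of a forest frame of \<open>x\<close>, the echelon form of \<open>y\<close>
  has the same zero pattern by \<open>basis_exchange_iff\<close>, and a forest pattern determines
  the space up to the torus.\<close>

lemma QGr_rigid:
  assumes r: "r \<le> CARD('n)" and x: "x \<in> (QGr r :: ('n::{finite,linorder}) cvec set set)"
    and y: "y \<in> Gr r" and eq: "matroid_bases y = matroid_bases x"
  shows "y \<in> torus_orbit x"
proof -
  obtain C \<rho> v where fr: "forest_frame C \<rho> v" and xv: "x = vec.span (v ` C)" and xG: "x \<in> Gr r"
    using QGr_forest_frame[OF r x] .
  let ?I = "\<rho> ` C"
  have subx: "vec.subspace x" and suby: "vec.subspace y" using xG y by (auto simp: Gr_def)
  have Ix: "?I \<in> matroid_bases x" unfolding xv by (rule forest_frame_basis(2)[OF fr])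
  then have Iy: "?I \<in> matroid_bases y" by (simp add: eq)
  have vf: "fund_vec x ?I (\<rho> c) = v c" if "c \<in> C" for c
    unfolding xv by (rule forest_frame_basis(3)[OF fr that])
  have "fund_vec y ?I (\<rho> c) $ k = 0 \<longleftrightarrow> v c $ k = 0" if c: "c \<in> C" for c k
  proof (cases "k \<in> ?I")
    case True
    then show ?thesis using fund_vec(2)[OF subx Ix True] fund_vec(2)[OF suby Iy True] vf[OF c] by metis
  next
    case False
    have "\<rho> c \<in> ?I" using c by simp
    then show ?thesis
      using basis_exchange_iff[OF subx Ix _ False] basis_exchange_iff[OF suby Iy _ False] vf[OF c] eq by metis
  qed
  then have "vec.span ((\<lambda>c. fund_vec y ?I (\<rho> c)) ` C) \<in> torus_orbit (vec.span (v ` C))"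
    by (rule forest_frame_orbit[OF fr])
  moreover have "vec.span ((\<lambda>c. fund_vec y ?I (\<rho> c)) ` C) = y"
    using span_fund_vec[OF suby Iy] by (simp add: image_image)
  ultimately show ?thesis by (simp add: xv)
qed

lemma QGr_unimodular:
  assumes r: "r \<le> CARD('n)" and x: "x \<in> (QGr r :: ('n::{finite,linorder}) cvec set set)"
  obtains y where "y \<in> torus_orbit x" "unimodular y"
proof -
  obtain C \<rho> v where fr: "forest_frame C \<rho> v" and xv: "x = vec.span (v ` C)"
    using QGr_forest_frame[OF r x] by blast
  define u where "u c = (\<chi> k. if v c $ k = 0 then 0 else (1 :: complex))" for c
  have uk: "u c $ k = (if v c $ k = 0 then 0 else 1)" for c k by (simp add: u_def)
  have nz: "u c $ k \<noteq> 0 \<longleftrightarrow> v c $ k \<noteq> 0" for c k by (simp add: uk)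
  have "shared_rows C u c = shared_rows C v c" for c by (simp only: shared_rows_def nz)
  then have forest: "order_forest C u" using fr by (simp add: forest_frame_def order_forest_def)
  have \<delta>: "u c $ \<rho> d = (if c = d then 1 else 0)" if "c \<in> C" "d \<in> C" for c d
    using fr that by (auto simp: forest_frame_def uk)
  have "unimodular (vec.span (u ` C))"
    by (rule order_forest_unimodular[OF _ forest \<delta>]) (simp_all add: uk)
  moreover have "vec.span (u ` C) \<in> torus_orbit x"
    unfolding xv by (rule forest_frame_orbit[OF fr]) (simp add: uk)
  ultimately show ?thesis by (intro that)
qed

lemma matroid_bases_orbit: "y \<in> torus_orbit x \<Longrightarrow> matroid_bases y = matroid_bases x"
  by (auto simp: torus_orbit_def matroid_bases_torus_act)

text \<open>The frame is taken from \<open>y\<close>, so the support reached by the degeneration is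
  a forest. It is enough to match that support, not the entries, because both spaces then lie in one
  torus orbit.\<close>

lemma QGr_mem_orbit_closure:
  assumes r: "r \<le> CARD('n)" and x: "x \<in> (QGr r :: ('n::{finite,linorder}) cvec set set)"
    and y: "y \<in> QGr r" and sub: "matroid_bases y \<subseteq> matroid_bases x"
  shows "y \<in> orbit_closure r x"
proof -
  have xG: "x \<in> Gr r" using QGr_forest_frame[OF r x] by blast
  obtain C \<rho> v where fr: "forest_frame C \<rho> v" and yv: "y = vec.span (v ` C)" and yG: "y \<in> Gr r"
    using QGr_forest_frame[OF r y] .
  obtain x' where x': "x' \<in> torus_orbit x" "unimodular x'" using QGr_unimodular[OF r x] .
  have x'G: "x' \<in> Gr r" using orbit_Gr[OF xG] x'(1) by blast
  define I where "I = \<rho> ` C"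
  have Iy: "I \<in> matroid_bases y" unfolding yv I_def by (rule forest_frame_basis(2)[OF fr])
  have Ix: "I \<in> matroid_bases x'" using Iy sub matroid_bases_orbit[OF x'(1)] by blast
  interpret exchange_graph x' y I
    using x'G yG x'(2) Iy sub matroid_bases_orbit[OF x'(1)] by unfold_locales (auto simp: Gr_def)
  obtain h :: "'n \<Rightarrow> nat" where h: "\<And>j k. j \<in> I \<Longrightarrow> A k j \<noteq> 0 \<Longrightarrow> h j \<le> h k"
    "\<And>j k. j \<in> I \<Longrightarrow> (h k = h j \<and> A k j \<noteq> 0) \<longleftrightarrow> B k j \<noteq> 0"
    using height_function by blast
  define w where "w j = (\<chi> k. if h k = h j then fund_vec x' I j $ k else 0)" for j
  let ?X = "orbit_closure r x"
  have "x' \<in> ?X" using x'(1) orbit_subset_closure[OF xG] by blast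
  then have orb: "torus_orbit x' \<subseteq> ?X" by (rule orbit_subset_invariant[OF torus_invariant_orbit_closure])
  have "vec.span (w ` I) \<in> ?X"
    unfolding w_def
    by (rule degeneration_in_closure[OF x'G Ix _ closedin_orbit_closure orb]) (use h(1) in \<open>simp add: A_def\<close>)
  moreover have "vec.span (w ` I) = vec.span ((\<lambda>c. w (\<rho> c)) ` C)" by (simp add: I_def image_image)
  moreover have "vec.span ((\<lambda>c. w (\<rho> c)) ` C) \<in> torus_orbit y"
    unfolding yv
  proof (rule forest_frame_orbit[OF fr])
    fix c k assume c: "c \<in> C"
    have "fund_vec y I (\<rho> c) = v c" unfolding yv I_def by (rule forest_frame_basis(3)[OF fr c])
    then have "v c $ k = B k (\<rho> c)" by (simp add: B_def)
    moreover have "w (\<rho> c) $ k = (if h k = h (\<rho> c) then A k (\<rho> c) else 0)" by (simp add: w_def A_def)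
    moreover have "\<rho> c \<in> I" using c by (simp add: I_def)
    ultimately show "w (\<rho> c) $ k = 0 \<longleftrightarrow> v c $ k = 0" using h(2)[of "\<rho> c" k] by auto
  qed
  ultimately have X: "vec.span (w ` I) \<in> ?X" and z: "y \<in> torus_orbit (vec.span (w ` I))"
    by (simp_all add: orbit_sym)
  show ?thesis by (rule subsetD[OF orbit_subset_invariant[OF torus_invariant_orbit_closure X] z])
qed

theorem theorem6p9:
  fixes r :: nat
  assumes "r \<le> CARD('n::{finite,linorder})"
  shows "(\<forall>X \<in> (QGr_orbit_closures r :: 'n cvec set set set).
            torus_invariant_subvariety r X \<and>
            (\<forall>Y. torus_invariant_subvariety r Y \<and> torus_fixed Y = torus_fixed X \<longrightarrow> Y = X))
       \<and> (\<forall>X \<in> (QGr_orbit_closures r :: 'n cvec set set set).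
            \<forall>Y \<in> QGr_orbit_closures r.
              Y \<subseteq> X \<longleftrightarrow> torus_fixed Y \<subseteq> torus_fixed X)"
proof -
  have G: "x \<in> Gr r" if "x \<in> QGr r" for x :: "'n cvec set"
    using QGr_forest_frame[OF assms that] by blast
  have closures: "(QGr_orbit_closures r :: 'n cvec set set set) = orbit_closure r ` QGr r"
    by (auto simp: QGr_orbit_closures_def orbit_closure_def)
  have "torus_invariant_subvariety r (orbit_closure r x) \<and>
    (\<forall>Y. torus_invariant_subvariety r Y \<and> torus_fixed Y = torus_fixed (orbit_closure r x) \<longrightarrow>
      Y = orbit_closure r x)" if x: "x \<in> QGr r" for x :: "'n cvec set"
    using orbit_closure_subvariety[OF G[OF x]]
      subvariety_eq_orbit_closure[OF G[OF x] QGr_rigid[OF assms x]] by blast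
  moreover have "orbit_closure r y \<subseteq> orbit_closure r x \<longleftrightarrow>
    torus_fixed (orbit_closure r y) \<subseteq> torus_fixed (orbit_closure r x)"
    if x: "x \<in> QGr r" and y: "y \<in> QGr r" for x y :: "'n cvec set"
  proof
    assume "orbit_closure r y \<subseteq> orbit_closure r x"
    then show "torus_fixed (orbit_closure r y) \<subseteq> torus_fixed (orbit_closure r x)"
      by (auto simp: torus_fixed_def)
  next
    assume f: "torus_fixed (orbit_closure r y) \<subseteq> torus_fixed (orbit_closure r x)"
    have "y \<in> orbit_closure r y" using orbit_subset_closure[OF G[OF y]] orbit_self by blast
    from matroid_bases_subset_if_fixed_subset[OF G[OF x] closedin_orbit_closure torus_invariant_orbit_closure f this]
    have "y \<in> orbit_closure r x" by (rule QGr_mem_orbit_closure[OF assms x y])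
    then show "orbit_closure r y \<subseteq> orbit_closure r x"
      by (intro orbit_closure_minimal closedin_orbit_closure
          orbit_subset_invariant[OF torus_invariant_orbit_closure])
  qed
  ultimately show ?thesis unfolding closures by blast
qed

end
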